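(* Let $p$ be an odd prime. For $\gamma=\begin{pmatrix} a & b\\ c& d\end{pmatrix}\in\Gamma_0^+(p)$, let $$\Phi_p(\gamma):=\begin{cases}\dfrac12\left[\Phi(\gamma)+\Phi\left(\begin{pmatrix} a & pb\\ c/p & d\end{pmatrix}\right)\right] & \text{for }\gamma\in\Gamma_0(p),\\[3mm] \Phi_p\left(\dfrac{1}{\sqrt p}\begin{pmatrix} c & d\\ -pa & -pb\end{pmatrix}\right)-3\operatorname{sgn}(-ac) & \text{for }\gamma\notin\Gamma_0(p),\end{cases}$$ and $$\eta_p(z):=\left(\eta(z)^k\eta(pz)^k\right)^{1/2k},$$ for a suitable positive integer $k$ (the integer $k$ and the choice of root are specified in the context). Then for all $\gamma=\begin{pmatrix} a & b\\ c& d\end{pmatrix}\in\Gamma_0^+(p)$ and all $z\in\mathfrak H$, $$\log\eta_p\left(\frac{az+b}{cz+d}\right)=\log\eta_p(z)+\frac12\operatorname{sgn}(c)^2\log\left(\frac{cz+d}{i\operatorname{sgn}(c)}\right)+\frac{\pi i}{12}\Phi_p(\gamma),$$ where the second term on the right is to be interpreted as $0$ if $c=0$.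
   Context: Notation. $\mathfrak H=\{z\in\mathbb C:\operatorname{Im}(z)>0\}$, and $\operatorname{sgn}$ is the sign function with $\operatorname{sgn}(0):=0$. Groups: $\Gamma_0(p)=\left\{\begin{pmatrix} a & b\\ c& d\end{pmatrix}\in \mathrm{SL}_2(\mathbb Z): c\equiv 0 \pmod p\right\}$, and $\Gamma_0^+(p)$ is the normalizer of $\Gamma_0(p)$ in $\mathrm{SL}_2(\mathbb R)$; it is generated by $\Gamma_0(p)$ and the Fricke involution $W_p=\frac{1}{\sqrt p}\begin{pmatrix}0&-1\\ p&0\end{pmatrix}$. For $\gamma=\begin{pmatrix} a & b\\ c& d\end{pmatrix}\in\Gamma_0^+(p)\setminus\Gamma_0(p)$, the matrix $W_p^{-1}\gamma=\frac{1}{\sqrt p}\begin{pmatrix} c & d\\ -pa & -pb\end{pmatrix}$ lies in $\Gamma_0(p)$. Dedekind sums: for coprime integers $h,m$ (with $m\ge 1$), $s(h,m)=\sum_{\mu=1}^m \left(\!\left(\frac{h\mu}{m}\right)\!\right)\left(\!\left(\frac{\mu}{m}\right)\!\right)$, where $((x))=x-\lfloor x\rfloor-\frac12$ if $x\notin\mathbb Z$ and $((x))=0$ if $x\in\mathbb Z$. Rademacher symbol: for $\gamma=\begin{pmatrix} a & b\\ c& d\end{pmatrix}\in \mathrm{SL}_2(\mathbb Z)$, $\Phi(\gamma)=\frac bd$ if $c=0$, and $\Phi(\gamma)=\frac{a+d}{c}-12\operatorname{sgn}(c)\,s(d,|c|)$ if $c\neq0$. Eta function: $\eta(z)=q^{1/24}\prod_{n=1}^\infty(1-q^n)$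 with $q=e^{2\pi i z}$, for $z\in\mathfrak H$. The function $\eta_p$: let $k$ be the smallest positive even integer such that $\frac{p-1}{24}k$ is an integer, and let $\Delta_p(z):=\eta^k(z)\eta^k(pz)$. The $2k$-th root is defined by $\eta_p(z)=\exp\left(\frac{1}{2k}\log(\Delta_p(z))\right)$, where the principal branch of the logarithm is chosen, i.e. $\log z=\log|z|+i\arg z$ for $z\in\mathbb C\setminus\{0\}$ with $\arg z\in(-\pi,\pi]$.
   Formalization: Instead of the pointwise principal branch (for which the formula fails at translations z→z+n, as Im log is bounded), log Δ_p and log η_p denote the holomorphic logarithms on the upper half plane that agree with the principal branch on the imaginary axis. *)

theory Defs
  imports
    "HOL-Complex_Analysis.Complex_Analysis"
    "HOL-Computational_Algebra.Primes"
    "HOL-Algebra.Group_Action"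
begin

section \<open>Matrix groups\<close>

definition mat2 :: "'a::zero \<Rightarrow> 'a \<Rightarrow> 'a \<Rightarrow> 'a \<Rightarrow> 'a ^ 2 ^ 2" where
  "mat2 a b c d = vector [vector [a, b], vector [c, d]]"

lemma mat2_nth [simp]:
  "mat2 a b c d $ 1 $ 1 = a" "mat2 a b c d $ 1 $ 2 = b"
  "mat2 a b c d $ 2 $ 1 = c" "mat2 a b c d $ 2 $ 2 = d"
  by (simp_all add: mat2_def)

definition SL2R :: "(real ^ 2 ^ 2) monoid" where
  "SL2R = \<lparr>carrier = {A. det A = 1}, mult = (**), one = mat 1\<rparr>"

definition Gamma0 :: "nat \<Rightarrow> (real ^ 2 ^ 2) set" where
  "Gamma0 p = {mat2 (of_int a) (of_int b) (of_int c) (of_int d) | a b c d :: int.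
                 a * d - b * c = 1 \<and> int p dvd c}"

definition Gamma0_plus :: "nat \<Rightarrow> (real ^ 2 ^ 2) set" where
  "Gamma0_plus p = normalizer SL2R (Gamma0 p)"

lemma group_SL2R: "Group.group SL2R"
proof (rule groupI)
  fix A assume "A \<in> carrier SL2R"
  then have A: "det A = 1" by (simp add: SL2R_def)
  then have "invertible A" by (simp add: invertible_det_nz)
  then obtain B where B: "A ** B = mat 1" "B ** A = mat 1"
    by (auto simp: invertible_def)
  have "det B * det A = 1" using B(2) by (metis det_I det_mul)
  then show "\<exists>B\<in>carrier SL2R. B \<otimes>\<^bsub>SL2R\<^esub> A = \<one>\<^bsub>SL2R\<^esub>"
    using A B(2) by (intro bexI[of _ B]) (auto simp: SL2R_def)
qed (auto simp: SL2R_def det_mul matrix_mul_assoc)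

lemma Gamma0_subset_SL2R: "Gamma0 p \<subseteq> carrier SL2R"
  unfolding Gamma0_def SL2R_def
  by (auto simp: det_2 simp flip: of_int_mult of_int_diff)


section \<open>Dedekind sums and the symbols\<close>

definition sawtooth :: "real \<Rightarrow> real" where
  "sawtooth x = (if x \<in> \<int> then 0 else x - of_int \<lfloor>x\<rfloor> - 1 / 2)"

definition dedekind_sum :: "int \<Rightarrow> int \<Rightarrow> real" where
  "dedekind_sum h m =
     (\<Sum>\<mu> = 1..m. sawtooth (of_int (h * \<mu>) / of_int m) * sawtooth (of_int \<mu> / of_int m))"

text \<open>The symbol is only used for matrices with integer entries, where the two floors merely
  convert the lower entries from type real to type int.\<close>

definition rademacher_Phi :: "real ^ 2 ^ 2 \<Rightarrow> real" where
  "rademacher_Phi A =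
     (let a = A $ 1 $ 1; b = A $ 1 $ 2; c = A $ 2 $ 1; d = A $ 2 $ 2
      in if c = 0 then b / d
         else (a + d) / c - 12 * sgn c * dedekind_sum \<lfloor>d\<rfloor> \<lfloor>\<bar>c\<bar>\<rfloor>)"

definition Phi_Gamma0 :: "nat \<Rightarrow> real ^ 2 ^ 2 \<Rightarrow> real" where
  "Phi_Gamma0 p A =
     (let a = A $ 1 $ 1; b = A $ 1 $ 2; c = A $ 2 $ 1; d = A $ 2 $ 2
      in (rademacher_Phi A + rademacher_Phi (mat2 a (real p * b) (c / real p) d)) / 2)"

text \<open>In the second case the argument of \<open>Phi_Gamma0\<close> is the product of the inverse of the
  Fricke involution with \<open>A\<close>; for \<open>A\<close> in
  \<open>Gamma0_plus p - Gamma0 p\<close> it lies in \<open>Gamma0 p\<close>.\<close>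

definition Phi_p :: "nat \<Rightarrow> real ^ 2 ^ 2 \<Rightarrow> real" where
  "Phi_p p A =
     (let a = A $ 1 $ 1; b = A $ 1 $ 2; c = A $ 2 $ 1; d = A $ 2 $ 2
      in if A \<in> Gamma0 p then Phi_Gamma0 p A
         else Phi_Gamma0 p (mat2 (c / sqrt (real p)) (d / sqrt (real p))
                                 (- real p * a / sqrt (real p)) (- real p * b / sqrt (real p)))
              - 3 * sgn (- a * c))"


section \<open>Logarithms on the upper half plane\<close>

abbreviation upper_half_plane :: "complex set" where
  "upper_half_plane \<equiv> {z. Im z > 0}"

text \<open>
  For a function \<open>f\<close> on the upper half plane, \<open>upper_log f\<close> is the holomorphic logarithm of
  \<open>f\<close> that coincides with the principal branch \<open>Ln (f z)\<close> on the imaginary axis. It is used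
  for functions that are holomorphic and nonvanishing on the upper half plane and positive on the
  imaginary axis; for these it exists and is unique (lemmas \<open>is_upper_log_exists\<close> and
  \<open>is_upper_log_unique\<close> below).

  The pointwise composition \<open>Ln (f z)\<close> cannot be used on the whole half plane: its imaginary
  part is bounded and it jumps where \<open>f\<close> crosses the negative real axis, whereas the
  logarithm of an eta function gains a fixed imaginary amount under each translation
  \<open>z \<mapsto> z + 1\<close>.
\<close>

definition is_upper_log :: "(complex \<Rightarrow> complex) \<Rightarrow> (complex \<Rightarrow> complex) \<Rightarrow> bool" where
  "is_upper_log f L \<longleftrightarrow>
     L holomorphic_on upper_half_plane \<and>
     (\<forall>z\<in>upper_half_plane. exp (L z) = f z) \<and>
     (\<forall>y>0. L (\<i> * of_real y) = Ln (f (\<i> * of_real y)))"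

definition upper_log :: "(complex \<Rightarrow> complex) \<Rightarrow> complex \<Rightarrow> complex" where
  "upper_log f = (SOME L. is_upper_log f L)"


section \<open>The eta functions\<close>

definition dedekind_eta :: "complex \<Rightarrow> complex" where
  "dedekind_eta z =
     exp (2 * of_real pi * \<i> * z / 24) * (\<Prod>n. 1 - exp (2 * of_real pi * \<i> * z) ^ Suc n)"

definition k_p :: "nat \<Rightarrow> nat" where
  "k_p p = (LEAST k. 0 < k \<and> even k \<and> (real p - 1) / 24 * real k \<in> \<int>)"

definition Delta_p :: "nat \<Rightarrow> complex \<Rightarrow> complex" where
  "Delta_p p z = dedekind_eta z ^ k_p p * dedekind_eta (of_nat p * z) ^ k_p p"

definition eta_p :: "nat \<Rightarrow> complex \<Rightarrow> complex" where
  "eta_p p z = exp (1 / (2 * of_nat (k_p p)) * upper_log (Delta_p p) z)"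


subsection \<open>Existence and uniqueness of the logarithms\<close>

lemma convex_upper_half_plane: "convex upper_half_plane"
  using convex_halfspace_Im_gt[of 0] by simp

lemma open_upper_half_plane: "open upper_half_plane"
  using open_halfspace_Im_gt[of 0] by simp

lemma log_diff_constant:
  assumes S: "connected S" and f: "continuous_on S f" and g: "continuous_on S g"
    and eq: "\<And>z. z \<in> S \<Longrightarrow> exp (f z) = exp (g z :: complex)"
    and a: "a \<in> S" "f a = g a" and z: "z \<in> S"
  shows "f z = g z"
proof -
  have "(\<lambda>z. f z - g z) constant_on S"
  proof (rule continuous_discrete_range_constant[OF S])
    show "continuous_on S (\<lambda>z. f z - g z)" by (intro continuous_intros f g)
    fix x assume x: "x \<in> S"
    have "2 * pi \<le> norm ((f y - g y) - (f x - g x))"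
      if y: "y \<in> S" and ne: "f y - g y \<noteq> f x - g x" for y
    proof -
      have "exp (f y - g y) = 1" "exp (f x - g x) = 1"
        using eq[OF x] eq[OF y] by (simp_all add: exp_diff)
      then have "exp ((f y - g y) - (f x - g x)) = 1" by (simp add: exp_diff)
      then obtain n :: int where n: "Re ((f y - g y) - (f x - g x)) = 0"
          "Im ((f y - g y) - (f x - g x)) = of_int (2 * n) * pi"
        by (auto simp: exp_eq_1)
      have "n \<noteq> 0"
      proof
        assume "n = 0"
        then have "(f y - g y) - (f x - g x) = 0" using n by (simp add: complex_eq_iff)
        then show False using ne by simp
      qed
      then have "1 \<le> \<bar>real_of_int n\<bar>" by linarith
      then have "2 * pi \<le> \<bar>Im ((f y - g y) - (f x - g x))\<bar>"
        unfolding n(2) by (simp add: abs_mult)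
      then show ?thesis using abs_Im_le_cmod order_trans by blast
    qed
    moreover have "0 < 2 * pi" by simp
    ultimately show "\<exists>e>0. \<forall>y. y \<in> S \<and> f y - g y \<noteq> f x - g x \<longrightarrow>
        e \<le> norm ((f y - g y) - (f x - g x))"
      by blast
  qed
  then obtain w where w: "f z - g z = w" if "z \<in> S" for z
    unfolding constant_on_def by blast
  show ?thesis using w[OF a(1)] w[OF z] a(2) by simp
qed

lemma is_upper_log_exists:
  assumes f: "f holomorphic_on upper_half_plane"
    and nz: "\<And>z. z \<in> upper_half_plane \<Longrightarrow> f z \<noteq> 0"
    and pos: "\<And>y. y > 0 \<Longrightarrow> \<exists>r>0. f (\<i> * of_real y) = of_real r"
  shows "\<exists>L. is_upper_log f L"
proof -
  obtain g where g: "g holomorphic_on upper_half_plane"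
      and eg: "\<And>z. z \<in> upper_half_plane \<Longrightarrow> exp (g z) = f z"
    using holomorphic_logarithm_exists[OF convex_upper_half_plane open_upper_half_plane f nz, of \<i>]
    by auto
  define L where "L = (\<lambda>z. g z + (Ln (f \<i>) - g \<i>))"
  have L: "L holomorphic_on upper_half_plane"
    unfolding L_def by (intro holomorphic_intros g)
  have eL: "exp (L z) = f z" if "z \<in> upper_half_plane" for z
    using that eg[OF that] eg[of \<i>] nz[of \<i>] by (simp add: L_def exp_add exp_diff)
  have "L (\<i> * of_real y) = Ln (f (\<i> * of_real y))" if y: "y > 0" for y :: real
  proof (rule log_diff_constant[where S = "{0<..}" and a = 1 and z = y
        and f = "\<lambda>y. L (\<i> * of_real y)" and g = "\<lambda>y. Ln (f (\<i> * of_real y))"])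
    have im: "(\<lambda>y::real. \<i> * of_real y) ` {0<..} \<subseteq> upper_half_plane" by auto
    show "continuous_on {0<..} (\<lambda>y::real. L (\<i> * of_real y))"
      by (rule continuous_on_compose2[OF holomorphic_on_imp_continuous_on[OF L] _ im])
         (intro continuous_intros)
    have "continuous_on {0<..} (\<lambda>y::real. f (\<i> * of_real y))"
      by (rule continuous_on_compose2[OF holomorphic_on_imp_continuous_on[OF f] _ im])
         (intro continuous_intros)
    moreover have "f (\<i> * of_real y) \<notin> \<real>\<^sub>\<le>\<^sub>0" if "y \<in> {0<..}" for y :: real
      using pos[of y] that by (auto simp: complex_nonpos_Reals_iff)
    ultimately show "continuous_on {0<..} (\<lambda>y::real. Ln (f (\<i> * of_real y)))"
      by (rule continuous_on_Ln')
    show "exp (L (\<i> * of_real y)) = exp (Ln (f (\<i> * of_real y)))" if "y \<in> {0<..}" for y :: real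
      using that eL[of "\<i> * of_real y"] nz[of "\<i> * of_real y"] by simp
  qed (use y in \<open>auto simp: L_def\<close>)
  then have "is_upper_log f L"
    unfolding is_upper_log_def using L eL by auto
  then show ?thesis by blast
qed

lemma is_upper_log_unique:
  assumes "is_upper_log f L" "is_upper_log f L'" "z \<in> upper_half_plane"
  shows "L z = L' z"
proof (rule log_diff_constant[of upper_half_plane L L' \<i> z])
  show "connected upper_half_plane"
    by (rule convex_connected[OF convex_upper_half_plane])
  show "L \<i> = L' \<i>"
    using assms(1,2) unfolding is_upper_log_def by (metis mult_1_right of_real_1 zero_less_one)
  show "exp (L w) = exp (L' w)" if "w \<in> upper_half_plane" for w
    using assms(1,2) that unfolding is_upper_log_def by auto
qed (use assms in \<open>auto simp: is_upper_log_def intro!: holomorphic_on_imp_continuous_on\<close>)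

lemma is_upper_log_upper_log:
  assumes "is_upper_log f L"
  shows "is_upper_log f (upper_log f)"
  unfolding upper_log_def using someI[of "is_upper_log f", OF assms] .

definition euler_prod :: "complex \<Rightarrow> complex" where
  "euler_prod q = (\<Prod>n. 1 - q ^ Suc n)"

lemma convergent_euler_prod:
  fixes q :: "'a :: {real_normed_field, banach}"
  assumes "norm q < 1"
  shows "convergent_prod (\<lambda>n. 1 - q ^ Suc n)"
proof -
  have "summable (\<lambda>n. norm q * norm q ^ n)"
    using assms by (intro summable_mult summable_geometric) auto
  then have "abs_convergent_prod (\<lambda>n. 1 - q ^ Suc n)"
    by (simp add: abs_convergent_prod_conv_summable norm_mult norm_power)
  then show ?thesis by (rule abs_convergent_prod_imp_convergent_prod)
qed

lemma euler_factor_nonzero: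
  fixes q :: "'a :: real_normed_field"
  assumes "norm q < 1"
  shows "1 - q ^ Suc n \<noteq> 0"
proof
  assume "1 - q ^ Suc n = 0"
  then have "norm q ^ Suc n = 1" by (metis eq_iff_diff_eq_0 norm_one norm_power)
  then show False using assms power_Suc_less_one[of "norm q" n]
    by (cases "q = 0") auto
qed

lemma euler_prod_nonzero: "norm q < 1 \<Longrightarrow> euler_prod q \<noteq> 0"
  unfolding euler_prod_def
  by (intro prodinf_nonzero convergent_euler_prod euler_factor_nonzero)

lemma euler_prod_pos:
  assumes "0 < r" "r < 1"
  shows "\<exists>s>0. euler_prod (of_real r) = of_real s"
proof -
  have c: "convergent_prod (\<lambda>n. 1 - r ^ Suc n)"
    using assms by (intro convergent_euler_prod) auto
  have "(\<lambda>n. complex_of_real (1 - r ^ Suc n)) has_prod of_real (\<Prod>n. 1 - r ^ Suc n)"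
    using convergent_prod_has_prod[OF c] by (simp only: has_prod_of_real_iff)
  then have "euler_prod (of_real r) = of_real (\<Prod>n. 1 - r ^ Suc n)"
    unfolding euler_prod_def by (simp add: has_prod_iff)
  moreover have "0 < (\<Prod>n. 1 - r ^ Suc n)"
    using assms power_Suc_less_one[of r]
    by (intro less_0_prodinf c) auto
  ultimately show ?thesis by blast
qed

lemma holomorphic_euler_prod: "euler_prod holomorphic_on ball 0 1"
proof (rule holomorphic_uniform_sequence)
  show "(\<lambda>q. \<Prod>n<N. 1 - q ^ Suc n) holomorphic_on ball 0 1" for N
    by (intro holomorphic_intros)
  fix x :: complex assume x: "x \<in> ball 0 1"
  define d where "d = (1 - norm x) / 2"
  have d: "d > 0" "norm x + d < 1" using x by (auto simp: d_def field_simps)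
  have nq: "norm q \<le> norm x + d" if "q \<in> cball x d" for q
    using that norm_triangle_ineq[of x "q - x"] by (auto simp: dist_norm norm_minus_commute)
  have "uniformly_convergent_on (cball x d) (\<lambda>N q. \<Prod>n<N. 1 - q ^ Suc n)"
  proof (rule uniformly_convergent_on_prod')
    show "uniformly_convergent_on (cball x d) (\<lambda>N q. \<Sum>n<N. norm (1 - q ^ Suc n - 1))"
    proof (rule Weierstrass_m_test')
      show "summable (\<lambda>n. (norm x + d) * (norm x + d) ^ n)"
        using d by (intro summable_mult summable_geometric) (auto simp: abs_of_nonneg)
      show "norm (norm (1 - q ^ Suc n - 1)) \<le> (norm x + d) * (norm x + d) ^ n"
        if "q \<in> cball x d" for n q
        using power_mono[OF nq[OF that], of "Suc n"] by (simp add: norm_mult norm_power)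
    qed
  qed (auto intro!: continuous_intros)
  then obtain g where g: "uniform_limit (cball x d) (\<lambda>N q. \<Prod>n<N. 1 - q ^ Suc n) g sequentially"
    by (auto simp: uniformly_convergent_on_def)
  have "g q = euler_prod q" if "q \<in> cball x d" for q
  proof -
    have "(\<lambda>N. \<Prod>n<N. 1 - q ^ Suc n) \<longlonglongrightarrow> g q"
      using g that by (rule tendsto_uniform_limitI)
    moreover have "(\<lambda>N. \<Prod>n<N. 1 - q ^ Suc n) \<longlonglongrightarrow> euler_prod q"
      unfolding euler_prod_def using nq[OF that] d(2)
      by (intro has_prod_imp_tendsto' convergent_prod_has_prod convergent_euler_prod) auto
    ultimately show ?thesis by (rule LIMSEQ_unique)
  qed
  then have "uniform_limit (cball x d) (\<lambda>N q. \<Prod>n<N. 1 - q ^ Suc n) g sequentially \<longleftrightarrow>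
      uniform_limit (cball x d) (\<lambda>N q. \<Prod>n<N. 1 - q ^ Suc n) euler_prod sequentially"
    by (intro uniform_limit_cong' refl)
  with g have "uniform_limit (cball x d) (\<lambda>N q. \<Prod>n<N. 1 - q ^ Suc n) euler_prod sequentially"
    by (rule iffD1[rotated])
  moreover have "cball x d \<subseteq> ball 0 1" using nq d(2) by fastforce
  ultimately show "\<exists>d>0. cball x d \<subseteq> ball 0 1 \<and>
      uniform_limit (cball x d) (\<lambda>N q. \<Prod>n<N. 1 - q ^ Suc n) euler_prod sequentially"
    using d(1) by blast
qed simp

lemma dedekind_eta_altdef:
  "dedekind_eta z = exp (2 * of_real pi * \<i> * z / 24) * euler_prod (exp (2 * of_real pi * \<i> * z))"
  by (simp add: dedekind_eta_def euler_prod_def)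

lemma norm_nome_less_1: "Im z > 0 \<Longrightarrow> norm (exp (2 * of_real pi * \<i> * z)) < 1"
  by simp

lemma dedekind_eta_nonzero: "Im z > 0 \<Longrightarrow> dedekind_eta z \<noteq> 0"
  using euler_prod_nonzero[OF norm_nome_less_1] by (simp add: dedekind_eta_altdef)

lemma holomorphic_dedekind_eta: "dedekind_eta holomorphic_on upper_half_plane"
proof -
  have "(euler_prod \<circ> (\<lambda>z. exp (2 * of_real pi * \<i> * z))) holomorphic_on upper_half_plane"
    by (rule holomorphic_on_compose_gen[OF _ holomorphic_euler_prod])
       (auto intro!: holomorphic_intros)
  then show ?thesis
    unfolding dedekind_eta_altdef[abs_def] o_def by (intro holomorphic_intros) auto
qed

lemma dedekind_eta_pos:
  assumes "y > 0"
  shows "\<exists>r>0. dedekind_eta (\<i> * of_real y) = of_real r"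
proof -
  have *: "exp (2 * of_real pi * \<i> * (\<i> * of_real y) / 24) = complex_of_real (exp (- (2 * pi * y / 24)))"
          "exp (2 * of_real pi * \<i> * (\<i> * of_real y)) = complex_of_real (exp (- (2 * pi * y)))"
    by (simp_all add: exp_of_real[symmetric] algebra_simps)
  obtain s where "s > 0" "euler_prod (of_real (exp (- (2 * pi * y)))) = of_real s"
    using euler_prod_pos[of "exp (- (2 * pi * y))"] assms by auto
  then show ?thesis
    unfolding dedekind_eta_altdef *
    by (intro exI[of _ "exp (- (2 * pi * y / 24)) * s"]) auto
qed

lemma k_p: "0 < k_p p \<and> even (k_p p) \<and> (real p - 1) / 24 * real (k_p p) \<in> \<int>"
  unfolding k_p_def
proof (rule LeastI[of _ 24], intro conjI)
  have "(real p - 1) / 24 * real 24 = of_int (int p - 1)" by simp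
  then show "(real p - 1) / 24 * real 24 \<in> \<int>" by (metis Ints_of_int)
qed auto

context
  fixes p :: nat
  assumes p: "p > 0"
begin

lemma holomorphic_Delta_p: "Delta_p p holomorphic_on upper_half_plane"
proof -
  have "(dedekind_eta \<circ> (\<lambda>z. of_nat p * z)) holomorphic_on upper_half_plane"
    by (rule holomorphic_on_compose_gen[OF _ holomorphic_dedekind_eta])
       (use p in \<open>auto intro!: holomorphic_intros\<close>)
  then show ?thesis
    unfolding Delta_p_def[abs_def] o_def by (intro holomorphic_intros holomorphic_dedekind_eta)
qed

lemma Delta_p_nonzero: "Im z > 0 \<Longrightarrow> Delta_p p z \<noteq> 0"
  unfolding Delta_p_def using p by (simp add: dedekind_eta_nonzero)

lemma Delta_p_pos:
  assumes "y > 0"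
  shows "\<exists>r>0. Delta_p p (\<i> * of_real y) = of_real r"
proof -
  obtain r where r: "r > 0" "dedekind_eta (\<i> * of_real y) = of_real r"
    using dedekind_eta_pos[OF assms] by blast
  obtain s where s: "s > 0" "dedekind_eta (\<i> * of_real (real p * y)) = of_real s"
    using dedekind_eta_pos[of "real p * y"] assms p by auto
  have *: "of_nat p * (\<i> * of_real y) = \<i> * of_real (real p * y)" by simp
  show ?thesis unfolding Delta_p_def * r(2) s(2)
    using r(1) s(1) by (intro exI[of _ "r ^ k_p p * s ^ k_p p"]) simp
qed

lemma is_upper_log_Delta_p: "is_upper_log (Delta_p p) (upper_log (Delta_p p))"
  using is_upper_log_exists[OF holomorphic_Delta_p] Delta_p_nonzero Delta_p_pos
    is_upper_log_upper_log by blast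

lemma is_upper_log_eta_p: "is_upper_log (eta_p p) (upper_log (eta_p p))"
proof -
  let ?L = "upper_log (Delta_p p)"
  have L: "?L holomorphic_on upper_half_plane"
    and im: "\<And>y. y > 0 \<Longrightarrow> ?L (\<i> * of_real y) = Ln (Delta_p p (\<i> * of_real y))"
    using is_upper_log_Delta_p unfolding is_upper_log_def by auto
  have "\<exists>r>0. eta_p p (\<i> * of_real y) = of_real r" if y: "y > 0" for y
  proof -
    obtain r where r: "r > 0" "Delta_p p (\<i> * of_real y) = of_real r"
      using Delta_p_pos[OF y] by blast
    have "eta_p p (\<i> * of_real y) = of_real (exp (ln r / (2 * real (k_p p))))"
      unfolding eta_p_def im[OF y] r(2)
      using r(1) by (simp add: Ln_of_real exp_of_real[symmetric])
    then show ?thesis by (metis exp_gt_zero)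
  qed
  moreover have "eta_p p holomorphic_on upper_half_plane"
    unfolding eta_p_def[abs_def] by (intro holomorphic_intros L)
  ultimately have "\<exists>L. is_upper_log (eta_p p) L"
    by (intro is_upper_log_exists) (auto simp: eta_p_def)
  then show ?thesis using is_upper_log_upper_log by blast
qed

lemma eta_p_power:
  assumes "Im z > 0"
  shows "eta_p p z ^ (2 * k_p p) = Delta_p p z"
proof -
  have "eta_p p z ^ (2 * k_p p) = exp (upper_log (Delta_p p) z)"
    unfolding eta_p_def using k_p[of p] by (simp flip: exp_of_nat_mult)
  then show ?thesis using is_upper_log_Delta_p assms by (simp add: is_upper_log_def)
qed

end

end

theory Submission
  imports Defs "HOL-Computational_Algebra.Nth_Powers"
begin

text \<open>
  The function \<open>eta_p p\<close> is a square root of \<open>\<eta>(z) \<eta>(p z)\<close>, so its logarithm is the mean of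
  \<open>log \<eta>(z)\<close> and \<open>log \<eta>(p z)\<close> (\<open>upper_log_eta_p\<close>). If \<open>\<gamma>\<close> has integer entries \<open>a, b, c, d\<close> and
  \<open>p\<close> divides \<open>c\<close>, then \<open>z \<mapsto> \<gamma> z\<close> turns \<open>p z\<close> into its image under the integer matrix with entries
  \<open>a, p b, c / p, d\<close>, which has the same denominator \<open>c z + d\<close>. The formula for \<open>Gamma0 p\<close> is therefore
  the mean of two instances of Dedekind's formula for \<open>log \<eta>\<close> under the full modular group
  (\<open>log_eta_SL2Z\<close>). The other elements of the normalizer are products of the Fricke involution
  with elements of \<open>Gamma0 p\<close> (\<open>Gamma0_plus_cases\<close>); the involution exchanges the two factors
  \<open>\<eta>(z)\<close> and \<open>\<eta>(p z)\<close> up to inversions \<open>w \<mapsto> - 1 / w\<close>, and the correction \<open>3 sgn (- a c)\<close> accounts for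
  the quarter turn by which the sum of two logarithms differs from the logarithm on the right hand side
  (\<open>upper_log_eta_p_Fricke_coset\<close>).

  Dedekind's formula is proved with the Euclidean algorithm on the lower row \<open>(c, d)\<close>. A translation
  reduces \<open>d\<close> modulo \<open>c\<close> and an inversion exchanges the two; on the arithmetic side this is matched by
  the periodicity and the reciprocity law of the Dedekind sums (\<open>dedekind_sum_reciprocity\<close>).

  What remains is the inversion formula \<open>\<eta>(- 1 / \<tau>) = sqrt (\<tau> / \<i>) \<eta>(\<tau>)\<close>. Consider a theta function
  given by an infinite product with simple zeros at the points of the lattice
  \<open>\<int> \<tau> + \<int>\<close>. Passing to the lattice \<open>\<int> (- 1 / \<tau>) + \<int>\<close>, which is the same lattice up to
  scaling, changes it by an exponential and a constant only: the quotient is elliptic without poles,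
  hence constant by Liouville's theorem, and the constant is found by letting \<open>z\<close> tend to \<open>0\<close>
  (\<open>lattice_theta_inversion\<close>). At \<open>z = 1 / 2\<close> this becomes an identity between eta values. Let \<open>g y\<close>
  be the logarithm of the factor by which the inversion formula could fail at \<open>\<i> y\<close>. The identity says
  \<open>g (2 y) = 2 g y\<close>, while \<open>g (1 / y) = - g y\<close> because inversion is an involution, and these two
  equations force \<open>g = 0\<close> (\<open>dedekind_eta_inversion_imaginary_axis\<close>). The identity theorem extends the
  formula from the imaginary axis to the half plane.
\<close>


section \<open>Infinite \<open>q\<close>-products\<close>

text \<open>The infinite \<open>q\<close>-Pochhammer symbol, usually written \<open>(x; q)\<^sub>\<infinity>\<close>.\<close>
definition q_poch :: "complex \<Rightarrow> complex \<Rightarrow> complex" where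
  "q_poch q x = (\<Prod>n. 1 - q ^ n * x)"

lemma convergent_q_poch:
  assumes "norm q < 1"
  shows "convergent_prod (\<lambda>n. 1 - q ^ n * x :: complex)"
proof -
  have "summable (\<lambda>n. norm q ^ n * norm x)"
    using assms by (intro summable_mult2 summable_geometric) auto
  then have "abs_convergent_prod (\<lambda>n. 1 - q ^ n * x)"
    by (simp add: abs_convergent_prod_conv_summable norm_mult norm_power)
  then show ?thesis by (rule abs_convergent_prod_imp_convergent_prod)
qed

lemma q_poch_rec:
  assumes "norm q < 1"
  shows "q_poch q x = (1 - x) * q_poch q (q * x)"
proof (cases "x = 1")
  case True
  have "(\<lambda>n. 1 - q ^ n * x) has_prod (\<Prod>n. 1 - q ^ n * x)"
    by (intro convergent_prod_has_prod convergent_q_poch assms)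
  moreover have "1 - q ^ 0 * x = 0" using True by simp
  ultimately have "(\<Prod>n. 1 - q ^ n * x) = 0"
    by (rule has_prod_zeroI)
  then show ?thesis using True by (simp add: q_poch_def)
next
  case False
  have "q_poch q x = (\<Prod>n. 1 - q ^ Suc n * x) * (1 - x)"
    using prodinf_split_initial_segment[OF convergent_q_poch[OF assms, of x], of 1] False
    by (simp add: q_poch_def)
  then show ?thesis by (simp add: q_poch_def mult_ac)
qed

text \<open>A convergent product vanishes only if one of its factors does; conversely, a factor zero at
  position \<open>n\<close> is moved to the front by \<open>n\<close> applications of the recursion.\<close>
lemma q_poch_eq_0_iff:
  assumes "norm q < 1"
  shows "q_poch q x = 0 \<longleftrightarrow> (\<exists>n. q ^ n * x = 1)"
proof
  assume "q_poch q x = 0"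
  then show "\<exists>n. q ^ n * x = 1"
    using prodinf_nonzero[OF convergent_q_poch[OF assms, of x]] unfolding q_poch_def
    by (metis eq_iff_diff_eq_0)
next
  assume "\<exists>n. q ^ n * x = 1"
  then obtain n where "q ^ n * x = 1" by blast
  then show "q_poch q x = 0"
  proof (induction n arbitrary: x)
    case 0
    then show ?case using q_poch_rec[OF assms, of x] by simp
  next
    case (Suc n)
    then show ?case using q_poch_rec[OF assms, of x] by (simp add: mult_ac)
  qed
qed

text \<open>The partial products converge uniformly on balls of radius \<open>1\<close>, with the geometric series
  as majorant.\<close>
lemma holomorphic_q_poch:
  assumes "norm q < 1"
  shows "q_poch q holomorphic_on UNIV"
proof (rule holomorphic_uniform_sequence)
  show "(\<lambda>x. \<Prod>n<N. 1 - q ^ n * x) holomorphic_on UNIV" for N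
    by (intro holomorphic_intros)
  fix x :: complex
  have "uniformly_convergent_on (cball x 1) (\<lambda>N x. \<Prod>n<N. 1 - q ^ n * x)"
  proof (rule uniformly_convergent_on_prod')
    show "uniformly_convergent_on (cball x 1) (\<lambda>N x. \<Sum>n<N. norm (1 - q ^ n * x - 1))"
    proof (rule Weierstrass_m_test')
      show "summable (\<lambda>n. norm q ^ n * (norm x + 1))"
        using assms by (intro summable_mult2 summable_geometric) auto
      show "norm (norm (1 - q ^ n * y - 1)) \<le> norm q ^ n * (norm x + 1)"
        if "y \<in> cball x 1" for n y
        using that norm_triangle_ineq[of x "y - x"]
        by (auto simp: norm_mult norm_power dist_norm norm_minus_commute intro!: mult_left_mono)
    qed
  qed (auto intro!: continuous_intros)
  then obtain g where g: "uniform_limit (cball x 1) (\<lambda>N x. \<Prod>n<N. 1 - q ^ n * x) g sequentially"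
    by (auto simp: uniformly_convergent_on_def)
  have "g y = q_poch q y" if "y \<in> cball x 1" for y
  proof -
    have "(\<lambda>N. \<Prod>n<N. 1 - q ^ n * y) \<longlonglongrightarrow> g y"
      using g that by (rule tendsto_uniform_limitI)
    moreover have "(\<lambda>N. \<Prod>n<N. 1 - q ^ n * y) \<longlonglongrightarrow> q_poch q y"
      unfolding q_poch_def
      by (intro has_prod_imp_tendsto' convergent_prod_has_prod convergent_q_poch assms)
    ultimately show ?thesis by (rule LIMSEQ_unique)
  qed
  then have "uniform_limit (cball x 1) (\<lambda>N x. \<Prod>n<N. 1 - q ^ n * x) g sequentially \<longleftrightarrow>
      uniform_limit (cball x 1) (\<lambda>N x. \<Prod>n<N. 1 - q ^ n * x) (q_poch q) sequentially"
    by (intro uniform_limit_cong' refl)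
  with g show "\<exists>d>0. cball x d \<subseteq> UNIV \<and>
      uniform_limit (cball x d) (\<lambda>N x. \<Prod>n<N. 1 - q ^ n * x) (q_poch q) sequentially"
    by (intro exI[of _ 1]) auto
qed simp

lemma q_poch_self: "q_poch q q = euler_prod q"
  by (simp add: q_poch_def euler_prod_def mult.commute)

lemma q_poch_mult_uminus:
  assumes "norm q < 1"
  shows "q_poch q x * q_poch q (- x) = q_poch (q ^ 2) (x ^ 2)"
proof -
  have "q_poch q x * q_poch q (- x) = (\<Prod>n. (1 - q ^ n * x) * (1 - q ^ n * (- x)))"
    unfolding q_poch_def by (intro prodinf_mult convergent_q_poch assms)
  also have "\<dots> = q_poch (q ^ 2) (x ^ 2)"
    unfolding q_poch_def
    by (rule prodinf_cong) (simp add: algebra_simps power2_eq_square power_mult_distrib)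
  finally show ?thesis .
qed

text \<open>The factors with even and with odd index form products over powers of \<open>q\<^sup>2\<close>.\<close>
lemma q_poch_bisect:
  assumes "norm q < 1"
  shows "q_poch q x = q_poch (q ^ 2) x * q_poch (q ^ 2) (q * x)"
proof -
  have q2: "norm (q ^ 2) < 1" using assms by (simp add: norm_power power_less_one_iff)
  have "(\<lambda>N. \<Prod>n<2 * N. 1 - q ^ n * x) \<longlonglongrightarrow> q_poch q x"
  proof -
    have "(\<lambda>N. \<Prod>n<N. 1 - q ^ n * x) \<longlonglongrightarrow> q_poch q x"
      unfolding q_poch_def
      by (intro has_prod_imp_tendsto' convergent_prod_has_prod convergent_q_poch assms)
    moreover have "filterlim (\<lambda>N::nat. 2 * N) sequentially sequentially"
      by (rule filterlim_subseq) (simp add: strict_mono_def)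
    ultimately show ?thesis by (rule filterlim_compose)
  qed
  moreover have "(\<Prod>n<2 * N. 1 - q ^ n * x) =
      (\<Prod>n<N. 1 - (q ^ 2) ^ n * x) * (\<Prod>n<N. 1 - (q ^ 2) ^ n * (q * x))" for N
  proof (induction N)
    case (Suc N)
    have "(\<Prod>n<2 * Suc N. 1 - q ^ n * x) =
        (\<Prod>n<2 * N. 1 - q ^ n * x) * (1 - q ^ (2 * N) * x) * (1 - q ^ Suc (2 * N) * x)"
      by simp
    moreover have "q ^ Suc (2 * N) * x = (q ^ 2) ^ N * (q * x)" "q ^ (2 * N) = (q ^ 2) ^ N"
      by (simp_all add: power_mult)
    ultimately show ?case unfolding Suc.IH by (simp only: prod.lessThan_Suc mult_ac)
  qed simp
  moreover have "(\<lambda>N. (\<Prod>n<N. 1 - (q ^ 2) ^ n * x) * (\<Prod>n<N. 1 - (q ^ 2) ^ n * (q * x)))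
      \<longlonglongrightarrow> q_poch (q ^ 2) x * q_poch (q ^ 2) (q * x)"
    unfolding q_poch_def
    by (intro tendsto_mult has_prod_imp_tendsto' convergent_prod_has_prod convergent_q_poch q2)
  ultimately show ?thesis by (simp only: LIMSEQ_unique)
qed


section \<open>A theta function with simple zeros at the lattice points\<close>

text \<open>The variable \<open>q\<close> of the eta product; here \<open>q\<close> is \<open>exp (2 pi \<i> z)\<close>, not its square root.\<close>
definition nome :: "complex \<Rightarrow> complex" where
  "nome z = exp (2 * of_real pi * \<i> * z)"

lemma nome_nonzero [simp]: "nome z \<noteq> 0"
  by (simp add: nome_def)

lemma nome_0 [simp]: "nome 0 = 1"
  by (simp add: nome_def)

lemma nome_1 [simp]: "nome 1 = 1"
  by (simp add: nome_def)

lemma nome_add: "nome (z + w) = nome z * nome w"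
  by (simp add: nome_def ring_distribs exp_add)

lemma nome_minus: "nome (- z) = inverse (nome z)"
  by (simp add: nome_def exp_minus)

lemma nome_diff: "nome (z - w) = nome z / nome w"
  by (simp add: nome_def ring_distribs exp_diff)

lemma nome_of_nat_mult: "nome (of_nat n * z) = nome z ^ n"
  by (simp add: nome_def exp_of_nat_mult [symmetric] mult_ac)

lemma nome_half [simp]: "nome (1 / 2) = - 1"
  by (simp add: nome_def)

lemma nome_eq_1_iff: "nome z = 1 \<longleftrightarrow> (\<exists>n :: int. z = of_int n)"
  unfolding nome_def exp_eq_1 by (auto simp: complex_eq_iff)

lemma nome_of_int [simp]: "nome (of_int n) = 1"
  using nome_eq_1_iff by blast

lemma norm_nome_lt_1: "Im z > 0 \<Longrightarrow> norm (nome z) < 1"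
  using norm_nome_less_1 by (simp add: nome_def)

lemma dedekind_eta_nome: "dedekind_eta z = nome (z / 24) * euler_prod (nome z)"
  by (simp add: dedekind_eta_altdef nome_def)

text \<open>The product that the Jacobi triple product identity expands, without its factor that
  depends on \<open>q\<close> alone.\<close>
definition q_theta :: "complex \<Rightarrow> complex \<Rightarrow> complex" where
  "q_theta q x = q_poch q x * q_poch q (q / x)"

lemma q_theta_shift:
  assumes "norm q < 1" "q \<noteq> 0" "x \<noteq> 0"
  shows "q_theta q (q * x) = - q_theta q x / x"
proof -
  have "q / (q * x) = 1 / x" using assms by simp
  then have "q_theta q (q * x) = q_poch q (q * x) * ((1 - 1 / x) * q_poch q (q / x))"
    using q_poch_rec[OF assms(1), of "1 / x"] by (simp add: q_theta_def)
  also have "\<dots> = - ((1 - x) * q_poch q (q * x) * q_poch q (q / x)) / x"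
    using assms by (simp add: field_simps)
  finally show ?thesis using q_poch_rec[OF assms(1), of x] by (simp add: q_theta_def)
qed

lemma q_theta_eq_0_iff:
  assumes "Im \<tau> > 0"
  shows "q_theta (nome \<tau>) (nome z) = 0 \<longleftrightarrow> (\<exists>m n :: int. z = of_int m * \<tau> + of_int n)"
proof -
  have nq: "norm (nome \<tau>) < 1" using norm_nome_lt_1 assms .
  show ?thesis
  proof
    assume "q_theta (nome \<tau>) (nome z) = 0"
    then have "(\<exists>k. nome \<tau> ^ k * nome z = 1) \<or> (\<exists>k. nome \<tau> ^ k * (nome \<tau> / nome z) = 1)"
      using q_poch_eq_0_iff[OF nq] by (simp add: q_theta_def)
    then show "\<exists>m n :: int. z = of_int m * \<tau> + of_int n"
    proof (elim disjE exE)
      fix k assume "nome \<tau> ^ k * nome z = 1"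
      then have "nome (of_nat k * \<tau> + z) = 1" by (simp add: nome_add nome_of_nat_mult)
      then obtain n :: int where "of_nat k * \<tau> + z = of_int n" unfolding nome_eq_1_iff by blast
      then have "z = of_int (- int k) * \<tau> + of_int n" by (simp add: algebra_simps)
      then show ?thesis by blast
    next
      fix k assume "nome \<tau> ^ k * (nome \<tau> / nome z) = 1"
      then have "nome (of_nat k * \<tau> + (\<tau> - z)) = 1"
        by (simp add: nome_add nome_of_nat_mult nome_diff)
      then obtain n :: int where "of_nat k * \<tau> + (\<tau> - z) = of_int n" unfolding nome_eq_1_iff by blast
      then have "z = of_int (int (Suc k)) * \<tau> + of_int (- n)" by (simp add: algebra_simps)
      then show ?thesis by blast
    qed
  next
    assume "\<exists>m n :: int. z = of_int m * \<tau> + of_int n"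
    then obtain m n :: int where z: "z = of_int m * \<tau> + of_int n" by blast
    show "q_theta (nome \<tau>) (nome z) = 0"
    proof (cases "m \<le> 0")
      case True
      have "nome \<tau> ^ nat (- m) * nome z = nome (of_nat (nat (- m)) * \<tau> + z)"
        by (simp add: nome_add nome_of_nat_mult)
      also have "of_nat (nat (- m)) * \<tau> + z = of_int n"
        using True by (simp add: z)
      finally have "nome \<tau> ^ nat (- m) * nome z = 1" by simp
      then show ?thesis using q_poch_eq_0_iff[OF nq, of "nome z"] by (auto simp: q_theta_def)
    next
      case False
      have "nome \<tau> ^ nat (m - 1) * (nome \<tau> / nome z) = nome (of_nat (nat (m - 1)) * \<tau> + (\<tau> - z))"
        by (simp add: nome_add nome_of_nat_mult nome_diff)
      also have "of_nat (nat (m - 1)) * \<tau> + (\<tau> - z) = of_int (- n)"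
        using False by (simp add: z algebra_simps)
      finally have "nome \<tau> ^ nat (m - 1) * (nome \<tau> / nome z) = 1"
        using nome_of_int[of "- n"] by simp
      then show ?thesis using q_poch_eq_0_iff[OF nq, of "nome \<tau> / nome z"] by (auto simp: q_theta_def)
    qed
  qed
qed

text \<open>A multiple of Jacobi's \<open>\<theta>\<^sub>1(z | \<tau>)\<close> by a factor independent of \<open>z\<close>. The exponential in
  front turns the invariance of \<open>q_theta\<close> under \<open>z \<mapsto> z + 1\<close> into a change of sign, which makes the
  roles of the periods \<open>1\<close> and \<open>\<tau>\<close> similar enough to be exchanged in \<open>lattice_theta_inversion\<close>.\<close>
definition lattice_theta :: "complex \<Rightarrow> complex \<Rightarrow> complex" where
  "lattice_theta \<tau> z = nome (- z / 2) * q_theta (nome \<tau>) (nome z)"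

context
  fixes \<tau> :: complex
  assumes Im_tau: "Im \<tau> > 0"
begin

lemma lattice_theta_eq_0_iff:
  "lattice_theta \<tau> z = 0 \<longleftrightarrow> (\<exists>m n :: int. z = of_int m * \<tau> + of_int n)"
  using q_theta_eq_0_iff[OF Im_tau] by (simp add: lattice_theta_def)

lemma lattice_theta_plus_1: "lattice_theta \<tau> (z + 1) = - lattice_theta \<tau> z"
proof -
  have "nome (- (z + 1) / 2) = nome (- z / 2) / nome (1 / 2)"
    unfolding nome_diff [symmetric] by (rule arg_cong[of _ _ nome]) (simp add: field_simps)
  then show ?thesis by (simp add: lattice_theta_def nome_add)
qed

lemma lattice_theta_plus_tau:
  "lattice_theta \<tau> (z + \<tau>) = - nome (- z - \<tau> / 2) * lattice_theta \<tau> z"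
proof -
  have 1: "q_theta (nome \<tau>) (nome (z + \<tau>)) = - q_theta (nome \<tau>) (nome z) / nome z"
    using q_theta_shift[OF norm_nome_lt_1[OF Im_tau], of "nome z"] by (simp add: nome_add mult_ac)
  have 2: "nome (- (z + \<tau>) / 2) = nome (- z / 2) * nome (- \<tau> / 2)"
    unfolding nome_add [symmetric] by (rule arg_cong[of _ _ nome]) (simp add: field_simps)
  have 3: "nome (- z - \<tau> / 2) = nome (- \<tau> / 2) / nome z"
    unfolding nome_diff [symmetric] by (rule arg_cong[of _ _ nome]) (simp add: field_simps)
  show ?thesis unfolding lattice_theta_def 1 2 3 by simp
qed

lemma holomorphic_lattice_theta: "lattice_theta \<tau> holomorphic_on A"
proof -
  have *: "q_poch (nome \<tau>) holomorphic_on UNIV"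
    by (rule holomorphic_q_poch[OF norm_nome_lt_1[OF Im_tau]])
  have "(q_poch (nome \<tau>) \<circ> nome) holomorphic_on UNIV"
    by (rule holomorphic_on_compose_gen[OF _ *])
       (auto simp: nome_def [abs_def] intro!: holomorphic_intros)
  moreover have "(q_poch (nome \<tau>) \<circ> (\<lambda>z. nome \<tau> / nome z)) holomorphic_on UNIV"
    by (rule holomorphic_on_compose_gen[OF _ *])
       (auto simp: nome_def [abs_def] intro!: holomorphic_intros)
  moreover have "(\<lambda>z. nome (- z / 2)) holomorphic_on UNIV"
    by (auto simp: nome_def [abs_def] intro!: holomorphic_intros)
  ultimately have "lattice_theta \<tau> holomorphic_on UNIV"
    unfolding lattice_theta_def [abs_def] q_theta_def [abs_def] o_def by (intro holomorphic_intros)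
  then show ?thesis by (rule holomorphic_on_subset) auto
qed

text \<open>The factor \<open>1 - nome z\<close> carries the simple zero at the origin; the remaining factors are
  holomorphic, and at \<open>z = 0\<close> both become Euler products.\<close>
lemma lattice_theta_deriv_0:
  "(lattice_theta \<tau> has_field_derivative - 2 * of_real pi * \<i> * euler_prod (nome \<tau>) ^ 2) (at 0)"
proof -
  define q where "q = nome \<tau>"
  have nq: "norm q < 1" unfolding q_def by (rule norm_nome_lt_1[OF Im_tau])
  have *: "q_poch q holomorphic_on UNIV"
    by (rule holomorphic_q_poch[OF nq])
  define B where "B = (\<lambda>z. nome (- z / 2) * q_poch q (q * nome z) * q_poch q (q / nome z))"
  have "(q_poch q \<circ> (\<lambda>z. q * nome z)) holomorphic_on UNIV"
    by (rule holomorphic_on_compose_gen[OF _ *])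
       (auto simp: nome_def [abs_def] intro!: holomorphic_intros)
  moreover have "(q_poch q \<circ> (\<lambda>z. q / nome z)) holomorphic_on UNIV"
    by (rule holomorphic_on_compose_gen[OF _ *])
       (auto simp: nome_def [abs_def] intro!: holomorphic_intros)
  moreover have "(\<lambda>z. nome (- z / 2)) holomorphic_on UNIV"
    by (auto simp: nome_def [abs_def] intro!: holomorphic_intros)
  ultimately have "B holomorphic_on UNIV"
    unfolding B_def o_def by (intro holomorphic_intros)
  then obtain B' where B': "(B has_field_derivative B') (at 0)"
    by (meson UNIV_I holomorphic_derivI open_UNIV)
  have "((\<lambda>z. 1 - nome z) has_field_derivative - 2 * of_real pi * \<i>) (at 0)"
    unfolding nome_def [abs_def] by (auto intro!: derivative_eq_intros)
  from DERIV_mult[OF this B']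
  have "((\<lambda>z. (1 - nome z) * B z) has_field_derivative - 2 * of_real pi * \<i> * B 0) (at 0)"
    by simp
  also have "B 0 = euler_prod q ^ 2"
    by (simp add: B_def q_poch_self power2_eq_square)
  also have "(\<lambda>z. (1 - nome z) * B z) = lattice_theta \<tau>"
  proof (rule ext)
    fix z
    show "(1 - nome z) * B z = lattice_theta \<tau> z"
      using q_poch_rec[OF nq, of "nome z"]
      by (simp add: B_def lattice_theta_def q_theta_def q_def [symmetric])
  qed
  finally show ?thesis by (simp add: q_def)
qed

end

lemma periodic_of_int_mult:
  fixes f :: "complex \<Rightarrow> 'a"
  assumes "\<And>z. f (z + g) = f z"
  shows "f (z + of_int n * g) = f z"
proof (induction n rule: int_induct[of _ 0])
  case (step1 i)
  then show ?case using assms[of "z + of_int i * g"] by (simp add: algebra_simps)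
next
  case (step2 i)
  then show ?case using assms[of "z + of_int (i - 1) * g"] by (simp add: algebra_simps)
qed simp

text \<open>All values are attained on the closed fundamental parallelogram, which is compact.\<close>
lemma bounded_range_doubly_periodic:
  assumes Im_tau: "Im \<tau> > 0" and cont: "continuous_on UNIV (f :: complex \<Rightarrow> complex)"
    and f1: "\<And>z. f (z + 1) = f z" and ft: "\<And>z. f (z + \<tau>) = f z"
  shows "bounded (range f)"
proof -
  define K where "K = (\<lambda>(s, t). of_real s + of_real t * \<tau>) ` ({0..1} \<times> {0..1 :: real})"
  have "compact K"
    unfolding K_def
    by (intro compact_continuous_image compact_Times compact_Icc)
       (auto simp: case_prod_unfold intro!: continuous_intros)
  then have "bounded (f ` K)"
    by (intro compact_imp_bounded compact_continuous_image continuous_on_subset[OF cont]) auto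
  moreover have "range f \<subseteq> f ` K"
  proof (rule image_subsetI)
    fix z
    define t where "t = Im z / Im \<tau>"
    define s where "s = Re z - t * Re \<tau>"
    have z: "z = of_real s + of_real t * \<tau>"
      using Im_tau by (simp add: complex_eq_iff s_def t_def)
    define w where "w = of_real (frac s) + of_real (frac t) * \<tau>"
    have "z = (w + of_int \<lfloor>t\<rfloor> * \<tau>) + of_int \<lfloor>s\<rfloor> * 1"
      by (simp add: z w_def frac_def algebra_simps)
    then have "f z = f w" using periodic_of_int_mult[of f 1, OF f1] periodic_of_int_mult[of f \<tau>, OF ft] by metis
    moreover have "w \<in> K"
      unfolding K_def w_def
      by (rule image_eqI[of _ _ "(frac s, frac t)"]) (auto simp: frac_lt_1 less_imp_le)
    ultimately show "f z \<in> f ` K" by auto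
  qed
  ultimately show ?thesis using bounded_subset by blast
qed

lemma euler_prod_nome_nonzero: "Im z > 0 \<Longrightarrow> euler_prod (nome z) \<noteq> 0"
  by (intro euler_prod_nonzero norm_nome_lt_1)

lemma Im_neg_inverse_pos: "Im z > 0 \<Longrightarrow> Im (- 1 / z) > 0"
  by (cases "z = 0") (auto simp: Im_divide intro!: divide_pos_pos add_nonneg_pos)

text \<open>As functions of \<open>z\<close>, both sides have the same zeros, all simple, and are multiplied by the same
  factors under \<open>z \<mapsto> z + 1\<close> and \<open>z \<mapsto> z + \<tau>\<close>; the Gaussian on the left is what compensates the
  different factors of the two theta functions. Their quotient is therefore an elliptic function
  without poles, hence constant, and its value is the limit at \<open>z = 0\<close>.\<close>
lemma lattice_theta_inversion:
  assumes Im_tau: "Im \<tau> > 0" and nz: "lattice_theta \<tau> z \<noteq> 0"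
  shows "nome (- (z ^ 2) / (2 * \<tau>)) * lattice_theta (- 1 / \<tau>) (z / \<tau>) =
           euler_prod (nome (- 1 / \<tau>)) ^ 2 / (\<tau> * euler_prod (nome \<tau>) ^ 2) * lattice_theta \<tau> z"
proof -
  define \<tau>' where "\<tau>' = - 1 / \<tau>"
  have \<tau>0: "\<tau> \<noteq> 0" using Im_tau by auto
  have Im_tau': "Im \<tau>' > 0"
    unfolding \<tau>'_def by (rule Im_neg_inverse_pos[OF Im_tau])
  define F where "F = lattice_theta \<tau>"
  define G where "G = (\<lambda>z. nome (- (z ^ 2) / (2 * \<tau>)) * lattice_theta \<tau>' (z / \<tau>))"
  define Q where "Q = (\<lambda>z. G z / F z)"
  define c where "c = euler_prod (nome \<tau>') ^ 2 / (\<tau> * euler_prod (nome \<tau>) ^ 2)"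
  have F_hol: "F holomorphic_on A" for A
    unfolding F_def by (rule holomorphic_lattice_theta[OF Im_tau])
  have G_hol: "G holomorphic_on A" for A
  proof -
    have "(lattice_theta \<tau>' \<circ> (\<lambda>z. z / \<tau>)) holomorphic_on A"
      by (rule holomorphic_on_compose_gen[OF _ holomorphic_lattice_theta[OF Im_tau', of UNIV]])
         (use \<tau>0 in \<open>auto intro!: holomorphic_intros\<close>)
    moreover have "(\<lambda>z. nome (- (z ^ 2) / (2 * \<tau>))) holomorphic_on A"
      unfolding nome_def using \<tau>0 by (auto intro!: holomorphic_intros)
    ultimately show ?thesis unfolding G_def o_def by (intro holomorphic_intros)
  qed
  have F1: "F (z + 1) = - F z" for z
    unfolding F_def by (rule lattice_theta_plus_1[OF Im_tau])
  have Ft: "F (z + \<tau>) = - nome (- z - \<tau> / 2) * F z" for z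
    unfolding F_def by (rule lattice_theta_plus_tau[OF Im_tau])
  \<comment> \<open>A step by \<open>1\<close> in \<open>z\<close> is a step by the quasi-period \<open>- \<tau>'\<close> in \<open>z / \<tau>\<close>, while a step by \<open>\<tau>\<close> in \<open>z\<close> is
    a step by \<open>1\<close> in \<open>z / \<tau>\<close>.\<close>
  have G1: "G (z + 1) = - G z" for z
  proof -
    have "(z + 1) / \<tau> + \<tau>' = z / \<tau>" using \<tau>0 by (simp add: \<tau>'_def field_simps)
    then have *: "lattice_theta \<tau>' (z / \<tau>) = - nome (- ((z + 1) / \<tau>) - \<tau>' / 2) * lattice_theta \<tau>' ((z + 1) / \<tau>)"
      using lattice_theta_plus_tau[OF Im_tau', of "(z + 1) / \<tau>"] by simp
    have "- G z = (nome (- (z ^ 2) / (2 * \<tau>)) * nome (- ((z + 1) / \<tau>) - \<tau>' / 2)) *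
        lattice_theta \<tau>' ((z + 1) / \<tau>)"
      unfolding G_def by (subst *) (simp only: mult_minus_right mult_minus_left minus_minus mult.assoc)
    also have "nome (- (z ^ 2) / (2 * \<tau>)) * nome (- ((z + 1) / \<tau>) - \<tau>' / 2) =
        nome (- ((z + 1) ^ 2) / (2 * \<tau>))"
      unfolding nome_add [symmetric]
      using \<tau>0 by (intro arg_cong[of _ _ nome]) (simp add: \<tau>'_def field_simps power2_eq_square)
    finally show ?thesis by (simp add: G_def)
  qed
  have Gt: "G (z + \<tau>) = - nome (- z - \<tau> / 2) * G z" for z
  proof -
    have "(z + \<tau>) / \<tau> = z / \<tau> + 1" using \<tau>0 by (simp add: field_simps)
    then have "lattice_theta \<tau>' ((z + \<tau>) / \<tau>) = - lattice_theta \<tau>' (z / \<tau>)"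
      using lattice_theta_plus_1[OF Im_tau', of "z / \<tau>"] by simp
    moreover have "nome (- ((z + \<tau>) ^ 2) / (2 * \<tau>)) = nome (- z - \<tau> / 2) * nome (- (z ^ 2) / (2 * \<tau>))"
      unfolding nome_add [symmetric]
      using \<tau>0 by (intro arg_cong[of _ _ nome]) (simp add: field_simps power2_eq_square)
    ultimately show ?thesis by (simp add: G_def)
  qed
  have Q1: "Q (z + 1) = Q z" for z by (simp add: Q_def F1 G1)
  have Qt: "Q (z + \<tau>) = Q z" for z by (simp add: Q_def Ft Gt)
  have per: "Q (of_int m * \<tau> + of_int n + z) = Q z" for m n :: int and z
  proof -
    have "Q ((z + of_int m * \<tau>) + of_int n * 1) = Q z"
      unfolding periodic_of_int_mult[of Q 1, OF Q1] periodic_of_int_mult[of Q \<tau>, OF Qt] ..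
    then show ?thesis by (simp add: algebra_simps)
  qed
  have F0: "F w = 0 \<longleftrightarrow> (\<exists>m n :: int. w = of_int m * \<tau> + of_int n)" for w
    unfolding F_def by (rule lattice_theta_eq_0_iff[OF Im_tau])
  have lim0: "Q \<midarrow>0\<rightarrow> c"
    unfolding Q_def
  proof (rule lhopital_complex_simple)
    show "(F has_field_derivative - 2 * of_real pi * \<i> * euler_prod (nome \<tau>) ^ 2) (at 0)"
      unfolding F_def by (rule lattice_theta_deriv_0[OF Im_tau])
    have "(lattice_theta \<tau>' has_field_derivative
        - 2 * of_real pi * \<i> * euler_prod (nome \<tau>') ^ 2) (at (0 / \<tau>))"
      using lattice_theta_deriv_0[OF Im_tau'] by simp
    moreover have "((\<lambda>z. z / \<tau>) has_field_derivative 1 / \<tau>) (at 0)"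
      using \<tau>0 by (auto intro!: derivative_eq_intros)
    ultimately have "((\<lambda>z. lattice_theta \<tau>' (z / \<tau>)) has_field_derivative
        - 2 * of_real pi * \<i> * euler_prod (nome \<tau>') ^ 2 * (1 / \<tau>)) (at 0)"
      by (rule DERIV_chain2)
    moreover have "((\<lambda>z. nome (- (z ^ 2) / (2 * \<tau>))) has_field_derivative 0) (at 0)"
      unfolding nome_def using \<tau>0 by (auto intro!: derivative_eq_intros)
    ultimately show "(G has_field_derivative
        - 2 * of_real pi * \<i> * euler_prod (nome \<tau>') ^ 2 / \<tau>) (at 0)"
      unfolding G_def by (auto intro!: derivative_eq_intros)
    show "F 0 = 0" using F0[of 0] by (auto intro: exI[of _ 0])
    have "lattice_theta \<tau>' 0 = 0"
      using lattice_theta_eq_0_iff[OF Im_tau', of 0] by (auto intro: exI[of _ 0])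
    then show "G 0 = 0" by (simp add: G_def)
    show "- 2 * of_real pi * \<i> * euler_prod (nome \<tau>) ^ 2 \<noteq> 0"
      using euler_prod_nome_nonzero[OF Im_tau] by simp
    show "- 2 * of_real pi * \<i> * euler_prod (nome \<tau>') ^ 2 / \<tau> /
        (- 2 * of_real pi * \<i> * euler_prod (nome \<tau>) ^ 2) = c"
      by (simp add: c_def)
  qed
  have lim: "Q \<midarrow>w\<rightarrow> c" if w0: "F w = 0" for w
  proof -
    obtain m n :: int where w: "w = of_int m * \<tau> + of_int n" using w0 F0 by blast
    have "(\<lambda>h. Q (w + h)) = Q" by (rule ext) (simp only: w per)
    then show ?thesis using lim0 LIM_offset_zero_cancel[of Q w c] by simp
  qed
  \<comment> \<open>At lattice points \<open>Q\<close> is \<open>0 / 0 = 0\<close>; \<open>R\<close> has the limit \<open>c\<close> there instead.\<close>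
  define R where "R = remove_sings Q"
  have ana: "Q analytic_on {w}" if "F w \<noteq> 0" for w
    unfolding Q_def using that
    by (intro analytic_intros)
       (use F_hol[of UNIV] G_hol[of UNIV] in \<open>auto simp: analytic_on_holomorphic\<close>)
  have R_F: "R w = (if F w = 0 then c else Q w)" for w
    using lim[of w] ana[of w] by (auto simp: R_def)
  have R_ana: "R analytic_on {w}" for w
  proof (cases "F w = 0")
    case True
    have "\<exists>r>0. \<forall>u\<in>ball w r - {w}. F u \<noteq> 0"
      using isolated_zeros[of F UNIV w z] True nz F_hol by (metis F_def UNIV_I connected_UNIV open_UNIV)
    then obtain r where r: "r > 0" "\<And>u. u \<in> ball w r - {w} \<Longrightarrow> F u \<noteq> 0" by blast
    have "Q analytic_on (ball w r - {w})"
      using ana r(2) by (subst analytic_on_analytic_at) blast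
    then have "isolated_singularity_at Q w"
      unfolding isolated_singularity_at_def using r(1) by blast
    then show ?thesis unfolding R_def using lim[OF True] by (rule remove_sings_analytic_at)
  next
    case False
    then show ?thesis unfolding R_def by (intro remove_sings_analytic_on ana)
  qed
  then have R_hol: "R holomorphic_on UNIV"
    by (metis UNIV_I analytic_imp_holomorphic analytic_on_analytic_at)
  have "R constant_on UNIV"
  proof (rule Liouville_theorem[OF R_hol])
    show "bounded (range R)"
    proof (rule bounded_range_doubly_periodic[OF Im_tau])
      show "continuous_on UNIV R" by (rule holomorphic_on_imp_continuous_on[OF R_hol])
    qed (simp_all add: R_F Q1 Qt F1 Ft)
  qed
  then have "R z = R 0" unfolding constant_on_def by (metis UNIV_I)
  moreover have "F 0 = 0" using F0[of 0] by (auto intro: exI[of _ 0])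
  ultimately have "Q z = c" using nz by (simp add: R_F F_def)
  then have "G z = c * F z" using nz by (simp add: Q_def F_def field_simps)
  then show ?thesis by (simp add: G_def F_def c_def \<tau>'_def)
qed


section \<open>The inversion of the eta function\<close>

text \<open>This is \<open>lattice_theta_inversion\<close> at \<open>z = 1 / 2\<close>. There the left theta function is taken at the half
  period \<open>1 / (2 \<tau>)\<close>, where its product runs over the odd powers of a square root of the nome. The
  bisection of products turns both sides into quotients of Euler products.\<close>
lemma dedekind_eta_half_period_relation:
  assumes Im_tau: "Im \<tau> > 0"
  shows "\<tau> * dedekind_eta (- 1 / \<tau> / 2) ^ 2 * dedekind_eta \<tau> ^ 4 =
           2 * \<i> * dedekind_eta (- 1 / \<tau>) ^ 4 * dedekind_eta (2 * \<tau>) ^ 2"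
proof -
  define \<tau>' where "\<tau>' = - 1 / \<tau>"
  have \<tau>0: "\<tau> \<noteq> 0" using Im_tau by auto
  have Im_tau': "Im \<tau>' > 0"
    unfolding \<tau>'_def by (rule Im_neg_inverse_pos[OF Im_tau])
  define q r where "q = nome \<tau>" and "r = nome (\<tau>' / 2)"
  \<comment> \<open>All nomes below are powers of \<open>u\<close> and \<open>v\<close>, so no choice of fractional powers of \<open>q\<close> is needed.\<close>
  define u v where "u = nome (\<tau>' / 48)" and "v = nome (\<tau> / 24)"
  have q: "norm q < 1" "q \<noteq> 0" and r: "norm r < 1" "r \<noteq> 0"
    unfolding q_def r_def using Im_tau Im_tau' by (auto intro!: norm_nome_lt_1)
  have r2: "norm (r ^ 2) < 1" using r(1) by (simp add: norm_power power_less_one_iff)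
  have u_power: "nome (of_nat n * (\<tau>' / 48)) = u ^ n" for n
    unfolding u_def by (rule nome_of_nat_mult)
  have v_power: "nome (of_nat n * (\<tau> / 24)) = v ^ n" for n
    unfolding v_def by (rule nome_of_nat_mult)
  have nome_\<tau>': "nome \<tau>' = r ^ 2" and nome_2\<tau>: "nome (2 * \<tau>) = q ^ 2"
    using nome_of_nat_mult[of 2 "\<tau>' / 2"] nome_of_nat_mult[of 2 \<tau>] by (simp_all add: q_def r_def)
  have r_u: "r = u ^ 24" using u_power[of 24] by (simp add: r_def)
  define P M where "P = q_poch (r ^ 2) r" and "M = q_poch q (- q)"
  have P: "P * euler_prod (r ^ 2) = euler_prod r"
    using q_poch_bisect[OF r(1), of r] by (simp add: P_def q_poch_self power2_eq_square [symmetric])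
  have M: "euler_prod q * M = euler_prod (q ^ 2)"
    using q_poch_mult_uminus[OF q(1), of q] by (simp add: M_def q_poch_self)
  have "lattice_theta \<tau> (1 / 2) = - \<i> * (2 * M ^ 2)"
  proof -
    have "2 * of_real pi * \<i> * (- (1 / 2) / 2) = - (\<i> * of_real (pi / 2))" by simp
    moreover have "exp (- (\<i> * of_real (pi / 2))) = - \<i>"
      by (simp only: exp_minus exp_Euler cos_of_real sin_of_real cos_pi_half sin_pi_half) simp
    ultimately have "nome (- (1 / 2) / 2) = - \<i>"
      unfolding nome_def by (simp only:)
    moreover have "q_theta q (- 1) = 2 * M ^ 2"
      using q_poch_rec[OF q(1), of "- 1"] by (simp add: q_theta_def M_def power2_eq_square)
    ultimately show ?thesis by (simp add: lattice_theta_def q_def)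
  qed
  moreover have "lattice_theta \<tau>' (1 / 2 / \<tau>) = u ^ 12 * (- (P ^ 2) / r)"
  proof -
    have z: "1 / 2 / \<tau> = - (\<tau>' / 2)" by (simp add: \<tau>'_def)
    have "q_theta (r ^ 2) r = P ^ 2"
      using r by (simp add: q_theta_def P_def power2_eq_square)
    then have "q_theta (r ^ 2) (inverse r) = - (P ^ 2) / r"
      using q_theta_shift[OF r2, of "inverse r"] r by (simp add: power2_eq_square field_simps)
    moreover have "nome (1 / 2 / \<tau>) = inverse r" by (simp only: z nome_minus r_def)
    moreover have "nome (- (1 / 2 / \<tau>) / 2) = u ^ 12"
      using u_power[of 12] by (simp only: z) simp
    ultimately show ?thesis by (simp only: lattice_theta_def nome_\<tau>')
  qed
  moreover have "nome (- ((1 / 2) ^ 2) / (2 * \<tau>)) = u ^ 6"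
  proof -
    have "- ((1 / 2) ^ 2) / (2 * \<tau>) = of_nat 6 * (\<tau>' / 48)"
      using \<tau>0 by (simp add: \<tau>'_def field_simps power2_eq_square)
    then show ?thesis by (simp only: u_power)
  qed
  moreover have "lattice_theta \<tau> (1 / 2) \<noteq> 0"
  proof
    assume "lattice_theta \<tau> (1 / 2) = 0"
    then obtain m n :: int where mn: "1 / 2 = of_int m * \<tau> + of_int n"
      using lattice_theta_eq_0_iff[OF Im_tau] by blast
    then have "m = 0" using Im_tau by (auto simp: complex_eq_iff)
    with mn have "complex_of_int (2 * n) = of_int 1" by (simp add: field_simps)
    then have "2 * n = 1" unfolding of_int_eq_iff .
    then show False by presburger
  qed
  note lattice_theta_inversion[OF Im_tau this]
  ultimately have "u ^ 6 * (u ^ 12 * (- (P ^ 2) / u ^ 24)) =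
      euler_prod (r ^ 2) ^ 2 / (\<tau> * euler_prod q ^ 2) * (- \<i> * (2 * M ^ 2))"
    by (simp only: \<tau>'_def [symmetric] nome_\<tau>' q_def [symmetric] r_u [symmetric])
  moreover have u0: "u \<noteq> 0" by (simp add: u_def)
  moreover have E0: "euler_prod q \<noteq> 0" using q by (intro euler_prod_nonzero)
  ultimately have *: "\<tau> * P ^ 2 * euler_prod q ^ 2 = 2 * \<i> * u ^ 6 * euler_prod (r ^ 2) ^ 2 * M ^ 2"
    using \<tau>0 by (simp add: field_simps power_add [symmetric])
       (simp add: eval_nat_numeral field_simps)
  have eta: "dedekind_eta (\<tau>' / 2) = u * euler_prod r" "dedekind_eta \<tau>' = u ^ 2 * euler_prod (r ^ 2)"
    "dedekind_eta \<tau> = v * euler_prod q" "dedekind_eta (2 * \<tau>) = v ^ 2 * euler_prod (q ^ 2)"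
    using u_power[of 2] v_power[of 2]
    by (simp_all add: dedekind_eta_nome nome_\<tau>' nome_2\<tau> q_def r_def u_def v_def)
  have "\<tau> * dedekind_eta (\<tau>' / 2) ^ 2 * dedekind_eta \<tau> ^ 4 =
      u ^ 2 * v ^ 4 * euler_prod (r ^ 2) ^ 2 * euler_prod q ^ 2 * (\<tau> * P ^ 2 * euler_prod q ^ 2)"
    unfolding eta P [symmetric] by (simp add: power_mult_distrib eval_nat_numeral)
  also have "\<dots> = 2 * \<i> * dedekind_eta \<tau>' ^ 4 * dedekind_eta (2 * \<tau>) ^ 2"
    unfolding * eta M [symmetric] by (simp add: power_mult_distrib eval_nat_numeral)
  finally show ?thesis by (simp add: \<tau>'_def)
qed

text \<open>Let \<open>g y\<close> be the defect \<open>ln (H (1 / y)) - ln y / 2 - ln (H y)\<close>. The half period relation gives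
  \<open>g (2 y) = 2 g y\<close>, and visibly \<open>g (1 / y) = - g y\<close>. Hence
  \<open>g y = - g (1 / y) = - 2 g (1 / (2 y)) = 2 g (2 y) = 4 g y\<close>, so \<open>g\<close> vanishes.\<close>
lemma dedekind_eta_inversion_imaginary_axis:
  obtains H :: "real \<Rightarrow> real" where
    "\<And>y. y > 0 \<Longrightarrow> H y > 0" "\<And>y. y > 0 \<Longrightarrow> dedekind_eta (\<i> * of_real y) = of_real (H y)"
    "\<And>y. y > 0 \<Longrightarrow> ln (H (1 / y)) = ln (H y) + ln y / 2"
proof -
  define H where "H = (\<lambda>y. Re (dedekind_eta (\<i> * of_real y)))"
  have H: "H y > 0" "dedekind_eta (\<i> * of_real y) = of_real (H y)" if "y > 0" for y
    using dedekind_eta_pos[OF that] by (auto simp: H_def)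
  define g where "g = (\<lambda>y. ln (H (1 / y)) - ln y / 2 - ln (H y))"
  have g_double: "g (2 * y) = 2 * g y" if y: "y > 0" for y
  proof -
    have arg: "- 1 / (\<i> * of_real y) = \<i> * complex_of_real (1 / y)"
      "\<i> * complex_of_real (1 / y) / 2 = \<i> * complex_of_real (1 / (2 * y))"
      "2 * (\<i> * of_real y) = \<i> * complex_of_real (2 * y)"
      using y by (simp_all add: field_simps)
    have "\<i> * of_real y * of_real (H (1 / (2 * y))) ^ 2 * of_real (H y) ^ 4 =
        2 * \<i> * of_real (H (1 / y)) ^ 4 * complex_of_real (H (2 * y)) ^ 2"
    proof -
      have "Im (\<i> * of_real y) > 0" using y by simp
      note dedekind_eta_half_period_relation[OF this]
      moreover have "y > 0" "1 / y > 0" "2 * y > 0" "1 / (2 * y) > 0" using y by simp_all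
      ultimately show ?thesis unfolding arg by (simp only: H(2))
    qed
    then have "\<i> * of_real (y * H (1 / (2 * y)) ^ 2 * H y ^ 4) =
        \<i> * complex_of_real (2 * H (1 / y) ^ 4 * H (2 * y) ^ 2)"
      by (simp add: mult_ac)
    then have "y * H (1 / (2 * y)) ^ 2 * H y ^ 4 = 2 * H (1 / y) ^ 4 * H (2 * y) ^ 2"
      by (simp only: mult_cancel_left complex_i_not_zero of_real_eq_iff simp_thms)
    then have "ln (y * H (1 / (2 * y)) ^ 2 * H y ^ 4) = ln (2 * H (1 / y) ^ 4 * H (2 * y) ^ 2)"
      by simp
    then have "ln y + 2 * ln (H (1 / (2 * y))) + 4 * ln (H y) =
        ln 2 + 4 * ln (H (1 / y)) + 2 * ln (H (2 * y))"
      using y H(1)[of y] H(1)[of "1 / y"] H(1)[of "2 * y"] H(1)[of "1 / (2 * y)"]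
      by (simp add: ln_mult ln_realpow)
    moreover have "ln (2 * y) = ln 2 + ln y" using y by (simp add: ln_mult)
    moreover have "a - (t + l) / 2 - B = 2 * (b - l / 2 - A)"
      if "l + 2 * a + 4 * A = t + 4 * b + 2 * B" for a b l t A B :: real
      using that by (simp add: field_simps)
    ultimately show ?thesis by (simp only: g_def)
  qed
  have g_inverse: "g (1 / y) = - g y" if "y > 0" for y
    using that by (simp add: g_def ln_div)
  have "g y = 0" if y: "y > 0" for y
  proof -
    have "g (1 / y) = 2 * g (1 / (2 * y))" using g_double[of "1 / (2 * y)"] y by simp
    then show ?thesis using g_inverse[of y] g_inverse[of "2 * y"] g_double[OF y] y by simp
  qed
  then have "ln (H (1 / y)) = ln (H y) + ln y / 2" if "y > 0" for y
    using that by (simp add: g_def algebra_simps)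
  then show ?thesis using H that[of H] by blast
qed

definition log_eta :: "complex \<Rightarrow> complex" where
  "log_eta = upper_log dedekind_eta"

lemma is_upper_log_log_eta: "is_upper_log dedekind_eta log_eta"
  unfolding log_eta_def
  using is_upper_log_exists[OF holomorphic_dedekind_eta] dedekind_eta_nonzero dedekind_eta_pos
    is_upper_log_upper_log by auto

lemma holomorphic_log_eta: "log_eta holomorphic_on upper_half_plane"
  and exp_log_eta: "Im z > 0 \<Longrightarrow> exp (log_eta z) = dedekind_eta z"
  and log_eta_imaginary_axis: "y > 0 \<Longrightarrow> log_eta (\<i> * of_real y) = Ln (dedekind_eta (\<i> * of_real y))"
  using is_upper_log_log_eta by (auto simp: is_upper_log_def)

text \<open>On the imaginary axis all three logarithms are real and the formula is the one just proved;
  both sides are holomorphic.\<close>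
lemma log_eta_inversion:
  assumes z: "Im z > 0"
  shows "log_eta (- 1 / z) = log_eta z + Ln (z / \<i>) / 2"
proof -
  have "log_eta (- 1 / z) - (log_eta z + Ln (z / \<i>) / 2) = 0"
  proof (rule analytic_continuation[where f = "\<lambda>w. log_eta (- 1 / w) - (log_eta w + Ln (w / \<i>) / 2)"
        and S = upper_half_plane and U = "{w. Re w = 0 \<and> Im w > 0}" and \<xi> = \<i> and w = z])
    show "open upper_half_plane" by (rule open_upper_half_plane)
    show "connected upper_half_plane" by (rule convex_connected[OF convex_upper_half_plane])
    let ?U = "{w. Re w = 0 \<and> Im w > 0}"
    show "?U \<subseteq> upper_half_plane" by auto
    show "\<i> \<in> upper_half_plane" by simp
    show "\<i> islimpt ?U"
      unfolding islimpt_approachable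
    proof (intro allI impI)
      fix e :: real assume "e > 0"
      then show "\<exists>x'\<in>?U. x' \<noteq> \<i> \<and> dist x' \<i> < e"
        by (intro bexI[of _ "Complex 0 (1 + e / 2)"]) (auto simp: dist_norm cmod_def complex_eq_iff)
    qed
    have 1: "(log_eta \<circ> (\<lambda>w. - 1 / w)) holomorphic_on upper_half_plane"
      by (rule holomorphic_on_compose_gen[OF _ holomorphic_log_eta])
         (use Im_neg_inverse_pos in \<open>auto intro!: holomorphic_intros\<close>)
    have 2: "(\<lambda>w. Ln (w / \<i>)) holomorphic_on upper_half_plane"
      by (rule holomorphic_on_Ln') (auto simp: complex_nonpos_Reals_iff intro!: holomorphic_intros)
    show "(\<lambda>w. log_eta (- 1 / w) - (log_eta w + Ln (w / \<i>) / 2)) holomorphic_on upper_half_plane"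
      by (intro holomorphic_on_diff holomorphic_on_add holomorphic_on_divide holomorphic_on_const
          holomorphic_log_eta 1 [unfolded o_def] 2) simp
    show "z \<in> upper_half_plane" using z by simp
    fix w assume "w \<in> ?U"
    define y where "y = Im w"
    have y: "y > 0" and w: "w = \<i> * of_real y"
      using \<open>w \<in> ?U\<close> by (auto simp: y_def complex_eq_iff)
    obtain H :: "real \<Rightarrow> real" where H: "\<And>y. y > 0 \<Longrightarrow> H y > 0"
        "\<And>y. y > 0 \<Longrightarrow> dedekind_eta (\<i> * of_real y) = of_real (H y)"
        "\<And>y. y > 0 \<Longrightarrow> ln (H (1 / y)) = ln (H y) + ln y / 2"
      using dedekind_eta_inversion_imaginary_axis by blast
    have L: "log_eta (\<i> * of_real x) = of_real (ln (H x))" if "x > 0" for x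
      using that H(1)[of x] by (simp add: log_eta_imaginary_axis H(2) Ln_of_real)
    have "- 1 / w = \<i> * of_real (1 / y)" using y by (simp add: w field_simps)
    moreover have "w / \<i> = of_real y" by (simp add: w)
    moreover have "1 / y > 0" using y by simp
    ultimately have "log_eta (- 1 / w) = of_real (ln (H y) + ln y / 2)"
        "log_eta w = of_real (ln (H y))" "Ln (w / \<i>) = of_real (ln y)"
      using y by (simp_all only: L H(3) Ln_of_real w)
    then show "log_eta (- 1 / w) - (log_eta w + Ln (w / \<i>) / 2) = 0"
      by simp
  qed
  then show ?thesis by simp
qed

text \<open>The Euler product has a holomorphic logarithm on the unit disc. As a function of \<open>nome z\<close>
  it is invariant under \<open>z \<mapsto> z + 1\<close>, so only the logarithm of \<open>nome (z / 24)\<close> changes.\<close>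
lemma log_eta_plus_1:
  assumes z: "Im z > 0"
  shows "log_eta (z + 1) = log_eta z + of_real pi * \<i> / 12"
proof -
  obtain l where l: "l holomorphic_on ball 0 1" and el: "\<And>q. q \<in> ball 0 1 \<Longrightarrow> exp (l q) = euler_prod q"
    using holomorphic_logarithm_exists[OF convex_ball open_ball holomorphic_euler_prod, of 0]
      euler_prod_nonzero by auto
  define L where "L = (\<lambda>z. 2 * of_real pi * \<i> * (z / 24) + l (nome z))"
  have "(l \<circ> nome) holomorphic_on upper_half_plane"
    by (rule holomorphic_on_compose_gen[OF _ l])
       (auto simp: nome_def [abs_def] intro!: holomorphic_intros)
  then have L: "L holomorphic_on upper_half_plane"
    unfolding L_def o_def by (intro holomorphic_intros) auto
  have eL: "exp (L w) = dedekind_eta w" if "Im w > 0" for w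
    using el[of "nome w"] norm_nome_lt_1[OF that]
    by (simp add: L_def exp_add dedekind_eta_nome nome_def mult_ac)
  have "log_eta w - log_eta \<i> = L w - L \<i>" if "Im w > 0" for w
  proof (rule log_diff_constant[where S = upper_half_plane and a = \<i> and z = w])
    show "connected upper_half_plane" by (rule convex_connected[OF convex_upper_half_plane])
    show "exp (log_eta w - log_eta \<i>) = exp (L w - L \<i>)" if "w \<in> upper_half_plane" for w
      using that by (simp add: exp_diff exp_log_eta eL)
  qed (use that in \<open>auto intro!: continuous_on_diff continuous_on_const
      holomorphic_on_imp_continuous_on[OF L] holomorphic_on_imp_continuous_on[OF holomorphic_log_eta]\<close>)
  note diff = this
  have "log_eta (z + 1) - log_eta z = (log_eta (z + 1) - log_eta \<i>) - (log_eta z - log_eta \<i>)"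
    by simp
  also have "\<dots> = L (z + 1) - L z"
    using diff[OF z] diff[of "z + 1"] z by simp
  also have "\<dots> = of_real pi * \<i> / 12"
    by (simp add: L_def nome_add field_simps)
  finally show ?thesis by (simp only: diff_eq_eq add.commute)
qed


section \<open>Dedekind sums and their reciprocity law\<close>

lemma sawtooth_add_of_int [simp]: "sawtooth (x + of_int n) = sawtooth x"
proof -
  have "x + of_int n \<in> \<int> \<longleftrightarrow> x \<in> \<int>"
    by (metis Ints_add Ints_diff Ints_of_int add_diff_cancel_right')
  then show ?thesis by (simp add: sawtooth_def)
qed

lemma sawtooth_of_int [simp]: "sawtooth (of_int n) = 0"
  by (simp add: sawtooth_def)

lemma sawtooth_minus: "sawtooth (- x) = - sawtooth x"
proof (cases "x \<in> \<int>")
  case False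
  then have "\<lceil>x\<rceil> = \<lfloor>x\<rfloor> + 1" by (simp add: ceiling_altdef) (metis Ints_of_int)
  then have "\<lfloor>- x\<rfloor> = - \<lfloor>x\<rfloor> - 1" by (simp add: floor_minus)
  then show ?thesis using False by (simp add: sawtooth_def)
qed (simp add: sawtooth_def)

lemma dedekind_sum_add_mult:
  assumes "m > 0"
  shows "dedekind_sum (h + n * m) m = dedekind_sum h m"
proof -
  have "sawtooth (of_int ((h + n * m) * \<mu>) / of_int m) = sawtooth (of_int (h * \<mu>) / of_int m)" for \<mu>
  proof -
    have "of_int ((h + n * m) * \<mu>) / of_int m = of_int (h * \<mu>) / real_of_int m + of_int (n * \<mu>)"
      using assms by (simp add: field_simps)
    then show ?thesis by (simp only: sawtooth_add_of_int)
  qed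
  then show ?thesis by (simp add: dedekind_sum_def)
qed

lemma dedekind_sum_minus: "dedekind_sum (- h) m = - dedekind_sum h m"
proof -
  have "sawtooth (of_int (- h * \<mu>) / of_int m) = - sawtooth (of_int (h * \<mu>) / of_int m)" for \<mu>
    by (simp add: sawtooth_minus [symmetric])
  then show ?thesis by (simp add: dedekind_sum_def sum_negf [symmetric])
qed

lemma dedekind_sum_0: "dedekind_sum 0 m = 0"
  using sawtooth_of_int[of 0] by (simp add: dedekind_sum_def)

lemma bij_betw_mult_mod:
  fixes h k :: int
  assumes "coprime h k" "k > 0"
  shows "bij_betw (\<lambda>\<mu>. h * \<mu> mod k) {1..k - 1} {1..k - 1}"
proof -
  have "inj_on (\<lambda>\<mu>. h * \<mu> mod k) {1..k - 1}"
  proof (rule inj_onI)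
    fix x y assume xy: "x \<in> {1..k - 1}" "y \<in> {1..k - 1}" and "h * x mod k = h * y mod k"
    then have "k dvd h * (x - y)" by (simp add: mod_eq_dvd_iff algebra_simps)
    then have "k dvd x - y"
      using assms(1) by (simp add: coprime_commute coprime_dvd_mult_right_iff)
    then have "\<bar>k\<bar> \<le> \<bar>x - y\<bar>" if "x \<noteq> y"
      using dvd_imp_le_int[of "x - y" k] that by simp
    then show "x = y" using xy by (cases "x = y") auto
  qed
  moreover have "(\<lambda>\<mu>. h * \<mu> mod k) ` {1..k - 1} \<subseteq> {1..k - 1}"
  proof (rule image_subsetI)
    fix \<mu> assume \<mu>: "\<mu> \<in> {1..k - 1}"
    have "\<not> k dvd h * \<mu>"
    proof
      assume "k dvd h * \<mu>"
      then have "k dvd \<mu>"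
        using assms(1) by (simp add: coprime_commute coprime_dvd_mult_right_iff)
      then show False using \<mu> zdvd_imp_le[of k \<mu>] by auto
    qed
    then have "h * \<mu> mod k \<noteq> 0" by (simp add: dvd_eq_mod_eq_0)
    moreover have "0 \<le> h * \<mu> mod k" "h * \<mu> mod k < k" using assms(2) by auto
    ultimately show "h * \<mu> mod k \<in> {1..k - 1}" by auto
  qed
  ultimately show ?thesis
    by (simp add: bij_betw_def endo_inj_surj)
qed

lemma sum_int:
  fixes n :: int
  assumes "n \<ge> 0"
  shows "2 * (\<Sum>i=1..n. i) = n * (n + 1)"
  using assms
proof (induction n rule: int_ge_induct)
  case (step i)
  have "{1..i + 1} = insert (i + 1) {1..i}" using step.hyps by auto
  then show ?case using step.IH by (simp add: algebra_simps)
qed simp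

lemma le_zdiv_iff:
  fixes k :: int
  assumes "k > 0"
  shows "m \<le> n div k \<longleftrightarrow> k * m \<le> n"
proof -
  have n: "k * (n div k) + n mod k = n" "0 \<le> n mod k" "n mod k < k" using assms by auto
  show ?thesis
  proof
    assume "m \<le> n div k"
    then have "k * m \<le> k * (n div k)" using assms by simp
    then show "k * m \<le> n" using n by linarith
  next
    assume km: "k * m \<le> n"
    show "m \<le> n div k"
    proof (rule ccontr)
      assume "\<not> m \<le> n div k"
      then have "k * (n div k + 1) \<le> k * m" using assms by simp
      then have "k * (n div k) + k \<le> k * m" by (simp only: ring_distribs mult_1_right)
      then show False using n km by linarith
    qed
  qed
qed

text \<open>Since \<open>n (n + 1)\<close> is twice the sum of \<open>1, \<dots>, n\<close>, the left hand side sums \<open>2 \<nu>\<close> over the lattice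
  points \<open>(\<mu>, \<nu>)\<close> of the open rectangle with sides \<open>k\<close> and \<open>h\<close> that lie below its diagonal, which
  contains none of them because \<open>h\<close> and \<open>k\<close> are coprime. The right hand side sums over \<open>\<mu>\<close> first.\<close>
lemma sum_floor_double_count:
  fixes h k :: int
  assumes "coprime h k" "h > 0" "k > 0"
  shows "(\<Sum>\<mu>=1..k - 1. (h * \<mu> div k) * (h * \<mu> div k + 1)) =
    (k - 1) * h * (h - 1) - 2 * (\<Sum>\<nu>=1..h - 1. \<nu> * (k * \<nu> div h))"
proof -
  have gauss: "n * (n + 1) = 2 * (\<Sum>\<nu>=1..n. \<nu>)" if "n \<ge> 0" for n :: int
    by (rule sum_int[OF that, symmetric])
  have "(\<Sum>\<mu>=1..k - 1. (h * \<mu> div k) * (h * \<mu> div k + 1)) =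
      (\<Sum>\<mu>=1..k - 1. \<Sum>\<nu>=1..h - 1. if k * \<nu> \<le> h * \<mu> then 2 * \<nu> else 0)"
  proof (rule sum.cong[OF refl])
    fix \<mu> assume \<mu>: "\<mu> \<in> {1..k - 1}"
    have iff: "\<nu> \<le> h * \<mu> div k \<longleftrightarrow> k * \<nu> \<le> h * \<mu>" for \<nu>
      using le_zdiv_iff[OF assms(3)] by simp
    have "h * \<mu> < h * k" using assms \<mu> by simp
    then have "h * \<mu> div k \<le> h - 1"
      using iff[of h] by (simp add: mult.commute)
    then have "{1..h * \<mu> div k} = {\<nu> \<in> {1..h - 1}. k * \<nu> \<le> h * \<mu>}"
      by (auto simp: iff [symmetric])
    moreover have "h * \<mu> div k \<ge> 0"
      using assms \<mu> by (simp add: pos_imp_zdiv_nonneg_iff)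
    moreover have "(\<Sum>\<nu>=1..h - 1. if k * \<nu> \<le> h * \<mu> then 2 * \<nu> else 0) =
        (\<Sum>\<nu>\<in>{\<nu> \<in> {1..h - 1}. k * \<nu> \<le> h * \<mu>}. 2 * \<nu>)"
      by (rule sum.inter_filter [symmetric]) simp
    ultimately show "(h * \<mu> div k) * (h * \<mu> div k + 1) =
        (\<Sum>\<nu>=1..h - 1. if k * \<nu> \<le> h * \<mu> then 2 * \<nu> else 0)"
      using gauss[of "h * \<mu> div k"] sum_distrib_left[of 2 "\<lambda>\<nu>. \<nu>" "{1..h * \<mu> div k}"]
      by metis
  qed
  also have "\<dots> = (\<Sum>\<nu>=1..h - 1. \<Sum>\<mu>=1..k - 1. if k * \<nu> \<le> h * \<mu> then 2 * \<nu> else 0)"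
    by (rule sum.swap)
  also have "\<dots> = (\<Sum>\<nu>=1..h - 1. 2 * \<nu> * (k - 1 - k * \<nu> div h))"
  proof (rule sum.cong[OF refl])
    fix \<nu> assume \<nu>: "\<nu> \<in> {1..h - 1}"
    have "\<not> h dvd k * \<nu>"
    proof
      assume "h dvd k * \<nu>"
      then have "h dvd \<nu>"
        using assms(1) by (simp add: coprime_dvd_mult_right_iff)
      then show False using \<nu> zdvd_imp_le[of h \<nu>] by auto
    qed
    then have ne: "h * \<mu> \<noteq> k * \<nu>" for \<mu>
      by (metis dvd_triv_left)
    have iff: "k * \<nu> \<le> h * \<mu> \<longleftrightarrow> k * \<nu> div h < \<mu>" for \<mu>
    proof -
      have "\<mu> \<le> k * \<nu> div h \<longleftrightarrow> h * \<mu> \<le> k * \<nu>"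
        by (rule le_zdiv_iff[OF assms(2)])
      then show ?thesis using ne[of \<mu>] by (cases "h * \<mu> \<le> k * \<nu>") auto
    qed
    have "k * \<nu> < k * h" using assms \<nu> by simp
    then have "k * \<nu> div h \<le> k - 1"
      using le_zdiv_iff[OF assms(2), of k "k * \<nu>"] by (simp add: mult.commute[of h k])
    moreover have "k * \<nu> div h \<ge> 0"
      using assms \<nu> by (simp add: pos_imp_zdiv_nonneg_iff)
    ultimately have "{\<mu> \<in> {1..k - 1}. k * \<nu> \<le> h * \<mu>} = {k * \<nu> div h + 1..k - 1}"
      by (auto simp: iff)
    then have "(\<Sum>\<mu>=1..k - 1. if k * \<nu> \<le> h * \<mu> then 2 * \<nu> else 0) =
        (\<Sum>\<mu>=k * \<nu> div h + 1..k - 1. 2 * \<nu>)"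
      by (simp add: sum.inter_filter [symmetric])
    also have "\<dots> = 2 * \<nu> * (k - 1 - k * \<nu> div h)"
      using \<open>k * \<nu> div h \<le> k - 1\<close> by simp
    finally show "(\<Sum>\<mu>=1..k - 1. if k * \<nu> \<le> h * \<mu> then 2 * \<nu> else 0) =
        2 * \<nu> * (k - 1 - k * \<nu> div h)" .
  qed
  also have "\<dots> = (\<Sum>\<nu>=1..h - 1. (k - 1) * (2 * \<nu>) - 2 * (\<nu> * (k * \<nu> div h)))"
    by (rule sum.cong) (simp_all add: algebra_simps)
  also have "\<dots> = (k - 1) * (2 * (\<Sum>\<nu>=1..h - 1. \<nu>)) - 2 * (\<Sum>\<nu>=1..h - 1. \<nu> * (k * \<nu> div h))"
    by (simp only: sum_subtractf sum_distrib_left)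
  also have "2 * (\<Sum>\<nu>=1..h - 1. \<nu>) = h * (h - 1)"
  proof -
    have "(h - 1) * (h - 1 + 1) = 2 * (\<Sum>\<nu>=1..h - 1. \<nu>)"
      by (rule gauss) (use assms in simp)
    then show ?thesis by (simp only: diff_add_cancel mult.commute)
  qed
  finally show ?thesis by (simp only: mult.assoc)
qed

lemma sum_squares_int:
  fixes n :: int
  assumes "n \<ge> 0"
  shows "6 * (\<Sum>i=1..n. i ^ 2) = n * (n + 1) * (2 * n + 1)"
  using assms
proof (induction n rule: int_ge_induct)
  case (step i)
  have "{1..i + 1} = insert (i + 1) {1..i}" using step.hyps by auto
  then show ?case using step.IH by (simp add: algebra_simps power2_eq_square)
qed simp

text \<open>For \<open>n\<close> not divisible by \<open>k\<close>, the sawtooth of \<open>n / k\<close> is \<open>(n mod k) / k - 1 / 2\<close>. The linear terms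
  of the product are known because multiplication by \<open>h\<close> permutes the nonzero residues.\<close>
lemma dedekind_sum_eq_sum_mod:
  assumes "coprime h k" "k > 0"
  shows "of_int k ^ 2 * dedekind_sum h k =
    of_int (\<Sum>\<mu>=1..k - 1. (h * \<mu> mod k) * \<mu>) - of_int (k ^ 2 * (k - 1)) / 4"
proof -
  have k0: "real_of_int k \<noteq> 0" using assms by simp
  have saw: "of_int k * sawtooth (of_int n / of_int k) = of_int (n mod k) - of_int k / 2"
    if "\<not> k dvd n" for n
  proof -
    have "real_of_int n / of_int k \<notin> \<int>"
      using that k0 by (simp add: of_int_div_of_int_in_Ints_iff)
    moreover have "\<lfloor>real_of_int n / of_int k\<rfloor> = n div k" by (rule floor_divide_of_int_eq)
    moreover have "real_of_int n = of_int k * of_int (n div k) + of_int (n mod k)"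
      by (metis mult_div_mod_eq of_int_add of_int_mult)
    ultimately show ?thesis using k0 by (simp add: sawtooth_def field_simps)
  qed
  have "{1..k} = insert k {1..k - 1}" using assms by auto
  moreover have "sawtooth (of_int k / of_int k) = 0"
    using k0 sawtooth_of_int[of 1] by simp
  ultimately have "of_int k ^ 2 * dedekind_sum h k = (\<Sum>\<mu>=1..k - 1.
      (of_int k * sawtooth (of_int (h * \<mu>) / of_int k)) * (of_int k * sawtooth (of_int \<mu> / of_int k)))"
    by (simp add: dedekind_sum_def sum_distrib_left power2_eq_square mult_ac)
  also have "\<dots> = (\<Sum>\<mu>=1..k - 1. of_int ((h * \<mu> mod k) * \<mu>) -
      of_int k / 2 * (of_int (h * \<mu> mod k) + of_int \<mu>) + of_int k ^ 2 / 4)"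
  proof (rule sum.cong[OF refl])
    fix \<mu> assume \<mu>: "\<mu> \<in> {1..k - 1}"
    then have 1: "\<not> k dvd \<mu>" using zdvd_imp_le[of k \<mu>] by auto
    then have 2: "\<not> k dvd h * \<mu>"
      using assms(1) by (simp add: coprime_commute coprime_dvd_mult_right_iff)
    have "\<mu> mod k = \<mu>" using \<mu> by (simp add: mod_pos_pos_trivial)
    then show "(of_int k * sawtooth (of_int (h * \<mu>) / of_int k)) * (of_int k * sawtooth (of_int \<mu> / of_int k)) =
        of_int ((h * \<mu> mod k) * \<mu>) -
        of_int k / 2 * (of_int (h * \<mu> mod k) + of_int \<mu>) + of_int k ^ 2 / 4"
      unfolding saw[OF 1] saw[OF 2] by (simp add: field_simps power2_eq_square)
  qed
  also have "\<dots> = of_int (\<Sum>\<mu>=1..k - 1. (h * \<mu> mod k) * \<mu>) -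
      of_int k / 2 * (of_int (\<Sum>\<mu>=1..k - 1. h * \<mu> mod k) + of_int (\<Sum>\<mu>=1..k - 1. \<mu>)) +
      of_int (k - 1) * of_int k ^ 2 / 4"
    using assms
    by (simp only: sum.distrib sum_subtractf sum_distrib_left [symmetric] of_int_sum) simp
  also have "(\<Sum>\<mu>=1..k - 1. h * \<mu> mod k) = (\<Sum>\<mu>=1..k - 1. \<mu>)"
    by (rule sum.reindex_bij_betw[OF bij_betw_mult_mod[OF assms]])
  also have "real_of_int (\<Sum>\<mu>=1..k - 1. \<mu>) = of_int (k * (k - 1)) / 2"
  proof -
    have "2 * (\<Sum>\<mu>=1..k - 1. \<mu>) = k * (k - 1)"
      using sum_int[of "k - 1"] assms by (simp add: mult.commute)
    then have "2 * real_of_int (\<Sum>\<mu>=1..k - 1. \<mu>) = of_int (k * (k - 1))"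
      by (metis of_int_mult of_int_numeral)
    then show ?thesis by simp
  qed
  finally show ?thesis by (simp add: field_simps power2_eq_square)
qed

text \<open>Multiplication by \<open>h\<close> permutes the nonzero residues modulo \<open>k\<close>, so the squares of
  \<open>h \<mu> - k (h \<mu> div k)\<close> have the same sum as the squares of \<open>\<mu>\<close>. Expanding the square produces
  the sum of \<open>\<mu> (h \<mu> div k)\<close>, which determines \<open>dedekind_sum h k\<close>, and the sum of the squares
  of \<open>h \<mu> div k\<close>, which \<open>sum_floor_double_count\<close> relates to \<open>dedekind_sum k h\<close>.\<close>
lemma dedekind_sum_reciprocity:
  assumes "coprime h k" "h > 0" "k > 0"
  shows "12 * (dedekind_sum h k + dedekind_sum k h) =
    (of_int h ^ 2 + of_int k ^ 2 + 1) / (of_int h * of_int k) - 3"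
proof -
  define A where "A = (\<Sum>\<mu>=1..k - 1. \<mu> * (h * \<mu> div k))"
  define B where "B = (\<Sum>\<nu>=1..h - 1. \<nu> * (k * \<nu> div h))"
  define S1 where "S1 = (\<Sum>\<mu>=1..k - 1. \<mu>)"
  define S2 where "S2 = (\<Sum>\<mu>=1..k - 1. \<mu> ^ 2)"
  define T2 where "T2 = (\<Sum>\<nu>=1..h - 1. \<nu> ^ 2)"
  define F1 where "F1 = (\<Sum>\<mu>=1..k - 1. h * \<mu> div k)"
  define F2 where "F2 = (\<Sum>\<mu>=1..k - 1. (h * \<mu> div k) ^ 2)"
  have md: "h * \<mu> mod k = h * \<mu> - k * (h * \<mu> div k)" for h k \<mu> :: int
    by (simp add: minus_mult_div_eq_mod)
  have S1: "2 * S1 = k * (k - 1)"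
    using sum_int[of "k - 1"] assms by (simp add: S1_def mult.commute)
  have S2: "6 * S2 = (k - 1) * k * (2 * k - 1)"
    using sum_squares_int[of "k - 1"] assms by (simp add: S2_def algebra_simps)
  have T2: "6 * T2 = (h - 1) * h * (2 * h - 1)"
    using sum_squares_int[of "h - 1"] assms by (simp add: T2_def algebra_simps)
  have "S1 = (\<Sum>\<mu>=1..k - 1. h * \<mu> mod k)"
    unfolding S1_def
    by (rule sum.reindex_bij_betw[OF bij_betw_mult_mod, symmetric]) (use assms in auto)
  also have "\<dots> = h * S1 - k * F1"
    unfolding md by (simp add: S1_def F1_def sum_subtractf sum_distrib_left)
  finally have F1: "k * F1 = h * S1 - S1" by simp
  have "S2 = (\<Sum>\<mu>=1..k - 1. (h * \<mu> mod k) ^ 2)"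
    unfolding S2_def
    by (rule sum.reindex_bij_betw[OF bij_betw_mult_mod, symmetric]) (use assms in auto)
  also have "\<dots> = h ^ 2 * S2 - 2 * h * k * A + k ^ 2 * F2"
    unfolding md
    by (simp add: S2_def A_def F2_def sum_subtractf sum.distrib sum_distrib_left
        power2_eq_square algebra_simps)
  finally have sq: "S2 = h ^ 2 * S2 - 2 * h * k * A + k ^ 2 * F2" .
  have F2: "F2 + F1 = (k - 1) * h * (h - 1) - 2 * B"
    using sum_floor_double_count[OF assms]
    by (simp add: F1_def F2_def B_def sum.distrib power2_eq_square algebra_simps)
  have "(\<Sum>\<mu>=1..k - 1. (h * \<mu> mod k) * \<mu>) = h * S2 - k * A"
    unfolding md
    by (simp add: S2_def A_def sum_subtractf sum_distrib_left power2_eq_square algebra_simps)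
  then have s: "real_of_int k ^ 2 * dedekind_sum h k = h * S2 - k * A - k ^ 2 * (k - 1) / 4"
    using dedekind_sum_eq_sum_mod[OF assms(1,3)] by simp
  have "(\<Sum>\<nu>=1..h - 1. (k * \<nu> mod h) * \<nu>) = k * T2 - h * B"
    unfolding md
    by (simp add: T2_def B_def sum_subtractf sum_distrib_left power2_eq_square algebra_simps)
  then have t: "real_of_int h ^ 2 * dedekind_sum k h = k * T2 - h * B - h ^ 2 * (h - 1) / 4"
    using dedekind_sum_eq_sum_mod[of k h] assms by (simp add: coprime_commute)
  have "k * (2 * F1) = (h - 1) * (2 * S1)" using F1 by (simp add: algebra_simps)
  then have "k * (2 * F1) = k * ((h - 1) * (k - 1))" unfolding S1 by (simp add: algebra_simps)
  then have F1': "2 * F1 = (h - 1) * (k - 1)" using assms(3) by simp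
  have AB: "2 * h * k * A + 2 * k ^ 2 * B = (h ^ 2 - 1) * S2 + k ^ 2 * ((k - 1) * h * (h - 1) - F1)"
  proof -
    have F2': "F2 = (k - 1) * h * (h - 1) - 2 * B - F1" using F2 by simp
    show ?thesis using sq unfolding F2' by (simp add: algebra_simps)
  qed
  define a b x y where "a = real_of_int A" and "b = real_of_int B"
    and "x = real_of_int h" and "y = real_of_int k"
  have pos: "x > 0" "y > 0" using assms by (auto simp: x_def y_def)
  have S2': "of_int S2 = (y - 1) * y * (2 * y - 1) / 6"
    using arg_cong[OF S2, of real_of_int] by (simp add: y_def)
  have T2': "of_int T2 = (x - 1) * x * (2 * x - 1) / 6"
    using arg_cong[OF T2, of real_of_int] by (simp add: x_def)
  have F1'': "of_int F1 = (x - 1) * (y - 1) / 2"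
    using arg_cong[OF F1', of real_of_int] by (simp add: x_def y_def)
  have AB': "2 * x * y * a + 2 * y ^ 2 * b = (x ^ 2 - 1) * ((y - 1) * y * (2 * y - 1) / 6) +
      y ^ 2 * ((y - 1) * x * (x - 1) - (x - 1) * (y - 1) / 2)"
    using arg_cong[OF AB, of real_of_int] unfolding S2' [symmetric] F1'' [symmetric]
    by (simp add: x_def y_def a_def b_def)
  define s t where "s = dedekind_sum h k" and "t = dedekind_sum k h"
  have s': "y ^ 2 * s = x * ((y - 1) * y * (2 * y - 1) / 6) - y * a - y ^ 2 * (y - 1) / 4"
    using s unfolding S2' [symmetric] by (simp add: x_def y_def a_def s_def)
  have t': "x ^ 2 * t = y * ((x - 1) * x * (2 * x - 1) / 6) - x * b - x ^ 2 * (x - 1) / 4"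
    using t unfolding T2' [symmetric] by (simp add: x_def y_def b_def t_def)
  have "x ^ 2 * y ^ 2 * (12 * x * y * (s + t)) = x ^ 2 * y ^ 2 * (x ^ 2 + y ^ 2 + 1 - 3 * x * y)"
  proof -
    \<comment> \<open>The unknowns \<open>a\<close> and \<open>b\<close> enter only through the combination that \<open>AB'\<close> evaluates.\<close>
    have "x ^ 2 * y ^ 2 * (12 * x * y * (s + t)) = 12 * x ^ 3 * y * (y ^ 2 * s) + 12 * x * y ^ 3 * (x ^ 2 * t)"
      by (simp add: algebra_simps power2_eq_square power3_eq_cube)
    also have "\<dots> = 12 * x ^ 3 * y * (x * ((y - 1) * y * (2 * y - 1) / 6) - y ^ 2 * (y - 1) / 4) +
        12 * x * y ^ 3 * (y * ((x - 1) * x * (2 * x - 1) / 6) - x ^ 2 * (x - 1) / 4) -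
        6 * x ^ 2 * y * (2 * x * y * a + 2 * y ^ 2 * b)"
      unfolding s' t' by (simp add: algebra_simps power2_eq_square power3_eq_cube)
    also have "\<dots> = x ^ 2 * y ^ 2 * (x ^ 2 + y ^ 2 + 1 - 3 * x * y)"
      unfolding AB' by (simp add: field_simps power2_eq_square power3_eq_cube)
    finally show ?thesis .
  qed
  then have "12 * x * y * (s + t) = x ^ 2 + y ^ 2 + 1 - 3 * x * y"
    using pos by simp
  then show ?thesis
    using pos unfolding s_def [symmetric] t_def [symmetric] x_def [symmetric] y_def [symmetric]
    by (simp add: field_simps)
qed


section \<open>The logarithm of eta under the modular group\<close>

text \<open>The arguments lie strictly between \<open>- pi / 2\<close> and \<open>pi / 2\<close>, so their sum is again a
  principal argument.\<close>
lemma Ln_mult_Re_pos: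
  assumes "Re u > 0" "Re v > 0"
  shows "Ln (u * v) = Ln u + Ln v"
proof -
  have nz: "u \<noteq> 0" "v \<noteq> 0" using assms by auto
  then have "\<bar>Im (Ln u)\<bar> < pi / 2" "\<bar>Im (Ln v)\<bar> < pi / 2"
    using assms Re_Ln_pos_lt by blast+
  then show ?thesis using nz by (intro Ln_times_simple) auto
qed

lemma Ln_mult_ii_Re_pos:
  assumes "Re u > 0" "s = 1 \<or> s = - 1"
  shows "Ln (\<i> * of_real s * u) = Ln u + \<i> * of_real s * of_real pi / 2"
proof -
  have nz: "u \<noteq> 0" using assms by auto
  then have u: "\<bar>Im (Ln u)\<bar> < pi / 2" using assms(1) Re_Ln_pos_lt by blast
  have "Ln (\<i> * of_real s) = \<i> * of_real s * of_real pi / 2"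
    using assms(2) by (auto simp: Ln_minus_ii)
  moreover have "Im (Ln (\<i> * of_real s)) = s * pi / 2"
    using assms(2) by (auto simp: Ln_minus_ii)
  ultimately show ?thesis
    using u nz assms(2) by (subst Ln_times_simple) auto
qed

lemma log_eta_plus_of_int:
  assumes z: "Im z > 0"
  shows "log_eta (z + of_int n) = log_eta z + of_int n * (of_real pi * \<i> / 12)"
proof -
  define t where "t = of_real pi * \<i> / 12"
  have "log_eta (z + of_int n) = log_eta z + of_int n * t"
  proof (induction n rule: int_induct[of _ 0])
    case (step1 i)
    then show ?case using log_eta_plus_1[of "z + of_int i", folded t_def] z by (simp add: algebra_simps)
  next
    case (step2 i)
    then show ?case using log_eta_plus_1[of "z + of_int (i - 1)", folded t_def] z by (simp add: algebra_simps)
  qed simp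
  then show ?thesis by (simp add: t_def)
qed

lemma coprime_SL2Z:
  fixes a b c d :: int
  assumes "a * d - b * c = 1"
  shows "coprime c d"
proof (rule coprimeI)
  fix e assume "e dvd c" "e dvd d"
  then have "e dvd a * d - b * c" by simp
  then show "is_unit e" using assms by simp
qed

lemma denominator_SL2Z_nonzero:
  fixes a b c d :: int
  assumes "a * d - b * c = 1" "Im z > 0"
  shows "of_int c * z + of_int d \<noteq> (0 :: complex)"
proof
  assume *: "of_int c * z + of_int d = (0 :: complex)"
  then have "of_int c * Im z = 0" by (simp add: complex_eq_iff)
  then have "c = 0" using assms(2) by simp
  then show False using * assms(1) by simp
qed

lemma Im_SL2Z_pos:
  fixes a b c d :: int
  assumes det: "a * d - b * c = 1" and z: "Im z > 0"
  shows "Im ((of_int a * z + of_int b) / (of_int c * z + of_int d)) > 0"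
proof -
  define v where "v = of_int c * z + of_int d"
  have "v \<noteq> 0" unfolding v_def by (rule denominator_SL2Z_nonzero[OF det z])
  then have "(Re v)\<^sup>2 + (Im v)\<^sup>2 > 0" by (simp add: complex_neq_0)
  moreover have "Im (of_int a * z + of_int b) * Re v - Re (of_int a * z + of_int b) * Im v =
      of_int (a * d - b * c) * Im z"
    by (simp add: v_def algebra_simps)
  then have "Im ((of_int a * z + of_int b) / v) = Im z / ((Re v)\<^sup>2 + (Im v)\<^sup>2)"
    by (simp add: Im_divide det)
  ultimately show ?thesis using z by (simp add: v_def)
qed

text \<open>Induction on \<open>c\<close> along the Euclidean algorithm. With \<open>r = d mod c\<close> and \<open>z' = z + d div c\<close> one has
  \<open>c z + d = c z' + r\<close>. If \<open>r = 0\<close>, then \<open>c = 1\<close> and the map is an inversion followed by a translation.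
  Otherwise it is the map with lower row \<open>(r, - c)\<close> applied to \<open>- 1 / z'\<close>, to which the
  induction hypothesis applies. The logarithms of the two denominators add up to that of
  \<open>c z' + r\<close> and a quarter turn, which accounts for the \<open>- 3\<close> in the reciprocity law.\<close>
lemma log_eta_SL2Z_pos:
  fixes a b c d :: int
  assumes "a * d - b * c = 1" "c > 0" "Im z > 0"
  shows "log_eta ((of_int a * z + of_int b) / (of_int c * z + of_int d)) =
    log_eta z + Ln ((of_int c * z + of_int d) / \<i>) / 2 +
    of_real pi * \<i> / 12 * of_real (of_int (a + d) / of_int c - 12 * dedekind_sum d c)"
  using assms
proof (induction "nat c" arbitrary: a b c d z rule: less_induct)
  case less
  note det = less.prems(1) and c = less.prems(2) and z = less.prems(3)
  define n r b' where "n = d div c" and "r = d mod c" and "b' = b - n * a"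
  define z' where "z' = z + of_int n"
  have d: "d = r + n * c" by (simp add: n_def r_def)
  have r: "0 \<le> r" "r < c" using c by (simp_all add: r_def)
  have det': "a * r - b' * c = 1" using det by (simp add: d b'_def algebra_simps)
  have z': "Im z' > 0" using z by (simp add: z'_def)
  have den: "of_int c * z + of_int d = of_int c * z' + of_int r"
    and num: "of_int a * z + of_int b = of_int a * z' + of_int b'"
    by (simp_all add: z'_def d b'_def algebra_simps)
  have s: "dedekind_sum d c = dedekind_sum r c"
    unfolding d by (rule dedekind_sum_add_mult[OF c])
  have frac: "real_of_int (a + d) / of_int c = of_int (a + r) / of_int c + of_int n"
    using c by (simp add: d field_simps)
  have shift: "log_eta z' = log_eta z + of_int n * (of_real pi * \<i> / 12)"
    unfolding z'_def by (rule log_eta_plus_of_int[OF z])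
  have "log_eta ((of_int a * z' + of_int b') / (of_int c * z' + of_int r)) =
      log_eta z' + Ln ((of_int c * z' + of_int r) / \<i>) / 2 +
      of_real pi * \<i> / 12 * of_real (of_int (a + r) / of_int c - 12 * dedekind_sum r c)"
  proof (cases "r = 0")
    case True
    then have "(- b') * c = 1" using det' by simp
    then have c1: "c = 1" and b1: "b' = - 1"
      using c zmult_eq_1_iff[of "- b'" c] by auto
    have "(of_int a * z' + of_int b') / (of_int c * z' + of_int r) = - 1 / z' + of_int a"
    proof -
      have "z' \<noteq> 0" using z' by auto
      then show ?thesis by (simp add: True c1 b1 field_simps)
    qed
    then show ?thesis
      using log_eta_plus_of_int[OF Im_neg_inverse_pos[OF z'], of a] log_eta_inversion[OF z']
      by (simp add: True c1 dedekind_sum_0)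
  next
    case False
    then have r_pos: "r > 0" using r by simp
    define w where "w = - 1 / z'"
    have z'0: "z' \<noteq> 0" using z' by auto
    have w: "Im w > 0" unfolding w_def by (rule Im_neg_inverse_pos[OF z'])
    have det_w: "b' * (- c) - (- a) * r = 1" using det' by (simp add: algebra_simps)
    have IH: "log_eta ((of_int b' * w + of_int (- a)) / (of_int r * w + of_int (- c))) =
        log_eta w + Ln ((of_int r * w + of_int (- c)) / \<i>) / 2 +
        of_real pi * \<i> / 12 * of_real (of_int (b' + - c) / of_int r - 12 * dedekind_sum (- c) r)"
      by (rule less.hyps[OF _ det_w r_pos w]) (use r c in simp)
    have arg: "(of_int b' * w + of_int (- a)) / (of_int r * w + of_int (- c)) =
        (of_int a * z' + of_int b') / (of_int c * z' + of_int r)"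
    proof -
      have "of_int b' * w + of_int (- a) = - ((of_int a * z' + of_int b') / z')"
        "of_int r * w + of_int (- c) = - ((of_int c * z' + of_int r) / z')"
        using z'0 by (simp_all add: w_def field_simps)
      then show ?thesis using z'0 by (simp only: minus_divide_divide) simp
    qed
    have inversion: "log_eta w = log_eta z' + Ln (z' / \<i>) / 2"
      unfolding w_def by (rule log_eta_inversion[OF z'])
    have Ln: "Ln ((of_int r * w + of_int (- c)) / \<i>) + Ln (z' / \<i>) =
        Ln ((of_int c * z' + of_int r) / \<i>) + \<i> * of_real pi / 2"
    proof -
      have "Re ((of_int r * w + of_int (- c)) / \<i>) > 0" "Re (z' / \<i>) > 0"
        using w z' r_pos by (simp_all add: Re_divide)
      then have "Ln ((of_int r * w + of_int (- c)) / \<i>) + Ln (z' / \<i>) =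
          Ln ((of_int r * w + of_int (- c)) / \<i> * (z' / \<i>))"
        by (rule Ln_mult_Re_pos [symmetric])
      also have "(of_int r * w + of_int (- c)) / \<i> * (z' / \<i>) =
          \<i> * of_real 1 * ((of_int c * z' + of_int r) / \<i>)"
        using z'0 by (simp add: w_def field_simps)
      also have "Ln \<dots> = Ln ((of_int c * z' + of_int r) / \<i>) + \<i> * of_real 1 * of_real pi / 2"
        by (rule Ln_mult_ii_Re_pos) (use c z' in \<open>auto simp: Re_divide\<close>)
      finally show ?thesis by simp
    qed
    have "3 + (of_int (b' + - c) / of_int r - 12 * dedekind_sum (- c) r) =
        of_int (a + r) / of_int c - 12 * dedekind_sum r c"
    proof -
      have "12 * (dedekind_sum c r + dedekind_sum r c) =
          (of_int c ^ 2 + of_int r ^ 2 + 1) / (of_int c * of_int r) - 3"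
        by (rule dedekind_sum_reciprocity[OF coprime_SL2Z[OF det'] c r_pos])
      moreover have "of_int (a + r) / of_int c - of_int (b' + - c) / real_of_int r =
          (of_int c ^ 2 + of_int r ^ 2 + 1) / (of_int c * of_int r)"
      proof -
        have "real_of_int a * of_int r - of_int b' * of_int c = 1"
          using arg_cong[OF det', of real_of_int] by simp
        then show ?thesis using c r_pos by (simp add: field_simps power2_eq_square)
      qed
      ultimately show ?thesis by (simp add: dedekind_sum_minus)
    qed
    then have "complex_of_real (of_int (a + r) / of_int c - 12 * dedekind_sum r c) =
        3 + of_real (of_int (b' + - c) / of_int r - 12 * dedekind_sum (- c) r)"
      by (metis of_real_add of_real_numeral)
    then have phase: "of_real pi * \<i> / 12 * of_real (of_int (a + r) / of_int c - 12 * dedekind_sum r c) =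
        \<i> * of_real pi / 4 +
        of_real pi * \<i> / 12 * of_real (of_int (b' + - c) / of_int r - 12 * dedekind_sum (- c) r)"
      by (simp only: ring_distribs) simp
    have "log_eta ((of_int a * z' + of_int b') / (of_int c * z' + of_int r)) =
        log_eta z' + (Ln ((of_int r * w + of_int (- c)) / \<i>) + Ln (z' / \<i>)) / 2 +
        of_real pi * \<i> / 12 * of_real (of_int (b' + - c) / of_int r - 12 * dedekind_sum (- c) r)"
      unfolding arg [symmetric] IH inversion by (simp add: add_divide_distrib)
    then show ?thesis
      unfolding Ln phase by (simp add: add_divide_distrib)
  qed
  moreover have "complex_of_real (of_int (a + d) / of_int c - 12 * dedekind_sum d c) =
      of_real (of_int (a + r) / of_int c - 12 * dedekind_sum r c) + of_int n"
    by (simp only: frac s) simp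
  ultimately show ?case
    unfolding den num shift by (simp only: ring_distribs) simp
qed

text \<open>A matrix and its negative act in the same way and have the same Rademacher symbol, which reduces
  \<open>c < 0\<close> to \<open>c > 0\<close>; for \<open>c = 0\<close> the map is a translation.\<close>
theorem log_eta_SL2Z:
  fixes a b c d :: int
  assumes det: "a * d - b * c = 1" and z: "Im z > 0"
  shows "log_eta ((of_int a * z + of_int b) / (of_int c * z + of_int d)) =
    log_eta z + (if c = 0 then 0 else Ln ((of_int c * z + of_int d) / (\<i> * of_int (sgn c))) / 2) +
    of_real pi * \<i> / 12 * of_real (rademacher_Phi (mat2 (of_int a) (of_int b) (of_int c) (of_int d)))"
proof -
  consider "c = 0" | "c > 0" | "c < 0" by linarith
  then show ?thesis
  proof cases
    case 1
    then have ad: "a * d = 1" using det by simp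
    then have d: "d = 1 \<and> a = 1 \<or> d = - 1 \<and> a = - 1" by (auto simp: zmult_eq_1_iff)
    then have "(of_int a * z + of_int b) / (of_int c * z + of_int d) = z + of_int (b * d)"
      using 1 by (auto simp: field_simps)
    moreover have "of_int b / real_of_int d = of_int (b * d)" using d by auto
    ultimately show ?thesis
      using log_eta_plus_of_int[OF z, of "b * d"] 1 by (simp add: rademacher_Phi_def)
  next
    case 2
    have "\<lfloor>\<bar>real_of_int c\<bar>\<rfloor> = c" using 2 by simp
    then show ?thesis using log_eta_SL2Z_pos[OF det 2 z] 2
      by (simp add: rademacher_Phi_def)
  next
    case neg: 3
    have "(- a) * (- d) - (- b) * (- c) = 1" "- c > 0" using det neg by auto
    note pos = log_eta_SL2Z_pos[OF this z]
    have 1: "(of_int (- a) * z + of_int (- b)) / (of_int (- c) * z + of_int (- d)) =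
        (of_int a * z + of_int b) / (of_int c * z + of_int d)"
      using minus_divide_divide[of "of_int a * z + of_int b" "of_int c * z + of_int d"] by simp
    have 2: "(of_int (- c) * z + of_int (- d)) / \<i> = (of_int c * z + of_int d) / (\<i> * of_int (sgn c))"
      using neg by (simp add: field_simps)
    have 3: "of_int (- a + - d) / of_int (- c) - 12 * dedekind_sum (- d) (- c) =
        rademacher_Phi (mat2 (of_int a) (of_int b) (of_int c) (of_int d))"
    proof -
      have "\<lfloor>\<bar>real_of_int c\<bar>\<rfloor> = - c" using neg by simp
      moreover have "real_of_int (- a + - d) / of_int (- c) = (of_int a + of_int d) / of_int c"
        using neg by (simp add: field_simps)
      ultimately show ?thesis using neg by (simp add: rademacher_Phi_def dedekind_sum_minus)
    qed
    show ?thesis using pos neg unfolding 1 2 3 by simp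
  qed
qed


section \<open>The logarithm of \<open>eta_p\<close> on \<open>Gamma0 p\<close> and its Fricke coset\<close>

text \<open>Logarithms that are holomorphic and real on the imaginary axis are unique, so the logarithm of
  \<open>Delta_p p\<close> is \<open>k_p p\<close> times the sum of those of the two eta factors, and the division
  by \<open>2 k_p p\<close> in \<open>eta_p\<close> leaves half that sum.\<close>
lemma upper_log_eta_p:
  assumes p: "p > 0" and z: "Im z > 0"
  shows "upper_log (eta_p p) z = (log_eta z + log_eta (of_nat p * z)) / 2"
proof -
  define k where "k = k_p p"
  have k: "k > 0" using k_p[of p] by (simp add: k_def)
  define M where "M = (\<lambda>z. log_eta z + log_eta (of_nat p * z))"
  have "(log_eta \<circ> (\<lambda>z. of_nat p * z)) holomorphic_on upper_half_plane"
    by (rule holomorphic_on_compose_gen[OF _ holomorphic_log_eta])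
       (use p in \<open>auto intro!: holomorphic_intros\<close>)
  then have M: "M holomorphic_on upper_half_plane"
    unfolding M_def o_def by (intro holomorphic_on_add holomorphic_log_eta)
  have M_real: "\<exists>x. M (\<i> * of_real y) = of_real x" if y: "y > 0" for y :: real
  proof -
    obtain r where r: "r > 0" "dedekind_eta (\<i> * of_real y) = of_real r"
      using dedekind_eta_pos[OF y] by blast
    have py: "real p * y > 0" using p y by simp
    obtain s where s: "s > 0" "dedekind_eta (\<i> * of_real (real p * y)) = of_real s"
      using dedekind_eta_pos[OF py] by blast
    have "of_nat p * (\<i> * of_real y) = \<i> * of_real (real p * y)" by simp
    then have "M (\<i> * of_real y) = of_real (ln r + ln s)"
      using r s log_eta_imaginary_axis[OF y] log_eta_imaginary_axis[OF py]
      by (simp only: M_def Ln_of_real of_real_add)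
    then show ?thesis by blast
  qed
  have "is_upper_log (Delta_p p) (\<lambda>z. of_nat k * M z)"
    unfolding is_upper_log_def
  proof (intro conjI ballI allI impI)
    show "(\<lambda>z. of_nat k * M z) holomorphic_on upper_half_plane"
      by (intro holomorphic_intros M)
    show exp: "exp (of_nat k * M z) = Delta_p p z" if "z \<in> upper_half_plane" for z
      using that p
      by (simp add: M_def Delta_p_def exp_of_nat_mult exp_add power_mult_distrib exp_log_eta k_def)
    fix y :: real assume y: "y > 0"
    obtain x where x: "M (\<i> * of_real y) = of_real x" using M_real[OF y] by blast
    have "Delta_p p (\<i> * of_real y) = of_real (exp (real k * x))"
      using exp[of "\<i> * of_real y"] y by (simp add: x flip: exp_of_real)
    then show "of_nat k * M (\<i> * of_real y) = Ln (Delta_p p (\<i> * of_real y))"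
      by (simp add: x Ln_of_real)
  qed
  then have L: "upper_log (Delta_p p) z = of_nat k * M z" if "z \<in> upper_half_plane" for z
    using is_upper_log_unique is_upper_log_Delta_p[OF p] that by blast
  have eta_p: "eta_p p z = exp (M z / 2)" if "z \<in> upper_half_plane" for z
    using L[OF that] k by (simp add: eta_p_def k_def [symmetric])
  have "is_upper_log (eta_p p) (\<lambda>z. M z / 2)"
    unfolding is_upper_log_def
  proof (intro conjI ballI allI impI)
    show "(\<lambda>z. M z / 2) holomorphic_on upper_half_plane"
      by (intro holomorphic_intros M) auto
    fix y :: real assume y: "y > 0"
    obtain x where x: "M (\<i> * of_real y) = of_real x" using M_real[OF y] by blast
    have "eta_p p (\<i> * of_real y) = of_real (exp (x / 2))"
      using eta_p[of "\<i> * of_real y"] y by (simp add: x exp_of_real [symmetric])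
    then show "M (\<i> * of_real y) / 2 = Ln (eta_p p (\<i> * of_real y))"
      by (simp add: x Ln_of_real)
  qed (simp add: eta_p)
  then have "upper_log (eta_p p) z = M z / 2"
    using is_upper_log_unique is_upper_log_eta_p[OF p] z by blast
  then show ?thesis by (simp add: M_def)
qed

text \<open>Both \<open>z\<close> and \<open>p z\<close> are transformed by integer matrices with the denominator \<open>c z + d\<close>, and
  the two Rademacher symbols are averaged.\<close>
lemma upper_log_eta_p_Gamma0:
  fixes a b c d :: int
  assumes p: "p > 0" and det: "a * d - b * c = 1" and dvd: "int p dvd c" and z: "Im z > 0"
  shows "upper_log (eta_p p) ((of_int a * z + of_int b) / (of_int c * z + of_int d)) =
    upper_log (eta_p p) z +
    (if c = 0 then 0 else Ln ((of_int c * z + of_int d) / (\<i> * of_int (sgn c))) / 2) +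
    of_real pi * \<i> / 12 * of_real (Phi_Gamma0 p (mat2 (of_int a) (of_int b) (of_int c) (of_int d)))"
proof -
  obtain c' where c: "c = int p * c'" using dvd by blast
  have det': "a * d - (int p * b) * c' = 1" using det by (simp add: c algebra_simps)
  have z': "Im (of_nat p * z) > 0" using p z by simp
  define w where "w = (of_int a * z + of_int b) / (of_int c * z + of_int d)"
  have w: "Im w > 0" unfolding w_def by (rule Im_SL2Z_pos[OF det z])
  have pw: "of_nat p * w = (of_int a * (of_nat p * z) + of_int (int p * b)) /
      (of_int c' * (of_nat p * z) + of_int d)"
    by (simp add: w_def c algebra_simps)
  have den: "of_int c' * (of_nat p * z) + of_int d = of_int c * z + (of_int d :: complex)"
    by (simp add: c)
  have sgn: "sgn c' = sgn c" and c0: "c' = 0 \<longleftrightarrow> c = 0"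
    using p by (simp_all add: c sgn_mult)
  have mat: "mat2 (of_int a) (real p * of_int b) (of_int c / real p) (of_int d) =
      mat2 (of_int a) (of_int (int p * b)) (of_int c') (real_of_int d)"
    using p by (simp add: c)
  define X where "X = (if c = 0 then 0 else Ln ((of_int c * z + of_int d) / (\<i> * of_int (sgn c))) / 2)"
  define \<phi> where "\<phi> = rademacher_Phi (mat2 (of_int a) (of_int b) (of_int c) (of_int d))"
  define \<phi>' where "\<phi>' = rademacher_Phi (mat2 (of_int a) (of_int (int p * b)) (of_int c') (of_int d))"
  have 1: "log_eta w = log_eta z + X + of_real pi * \<i> / 12 * of_real \<phi>"
    unfolding w_def X_def \<phi>_def by (rule log_eta_SL2Z[OF det z])
  have 2: "log_eta (of_nat p * w) = log_eta (of_nat p * z) + X + of_real pi * \<i> / 12 * of_real \<phi>'"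
    unfolding pw X_def \<phi>'_def using log_eta_SL2Z[OF det' z'] unfolding den sgn c0 .
  have 3: "Phi_Gamma0 p (mat2 (of_int a) (of_int b) (of_int c) (of_int d)) = (\<phi> + \<phi>') / 2"
    by (simp only: Phi_Gamma0_def Let_def mat2_nth mat \<phi>_def \<phi>'_def)
  show ?thesis
    unfolding w_def [symmetric] X_def [symmetric] upper_log_eta_p[OF p z] upper_log_eta_p[OF p w] 1 2 3
    by (simp add: field_simps)
qed

text \<open>At \<open>- 1 / (p z)\<close> the two eta factors are \<open>\<eta>(- 1 / (p z))\<close> and \<open>\<eta>(- 1 / z)\<close>, so the inversion formula
  applies at \<open>p z\<close> and at \<open>z\<close>; the two logarithms differ by \<open>ln p\<close>, and their mean has \<open>sqrt p\<close>.\<close>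
lemma upper_log_eta_p_fricke:
  assumes p: "p > 0" and z: "Im z > 0"
  shows "upper_log (eta_p p) (- 1 / (of_nat p * z)) =
    upper_log (eta_p p) z + Ln (of_real (sqrt (real p)) * z / \<i>) / 2"
proof -
  have z': "Im (of_nat p * z) > 0" using p z by simp
  have z0: "z \<noteq> 0" using z by auto
  have "of_nat p * (- 1 / (of_nat p * z)) = - 1 / z" using p by simp
  then have "upper_log (eta_p p) (- 1 / (of_nat p * z)) =
      (log_eta (- 1 / (of_nat p * z)) + log_eta (- 1 / z)) / 2"
    using upper_log_eta_p[OF p Im_neg_inverse_pos[OF z']] by simp
  also have "\<dots> = upper_log (eta_p p) z + (Ln (of_nat p * z / \<i>) + Ln (z / \<i>)) / 4"
    unfolding log_eta_inversion[OF z'] log_eta_inversion[OF z] upper_log_eta_p[OF p z]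
    by (simp add: field_simps)
  also have "Ln (of_nat p * z / \<i>) = of_real (ln (real p)) + Ln (z / \<i>)"
  proof -
    have "of_nat p * z / \<i> = of_real (real p) * (z / \<i>)" by simp
    moreover have "Ln (of_real (real p) * (z / \<i>)) = of_real (ln (real p)) + Ln (z / \<i>)"
      using p z0 by (simp only: Ln_times_of_real Ln_of_real of_nat_0_less_iff real_sqrt_gt_0_iff divide_eq_0_iff complex_i_not_zero simp_thms)
    ultimately show ?thesis by (simp only:)
  qed
  also have "of_real (ln (real p)) + Ln (z / \<i>) + Ln (z / \<i>) = 2 * Ln (of_real (sqrt (real p)) * z / \<i>)"
  proof -
    have "of_real (sqrt (real p)) * z / \<i> = of_real (sqrt (real p)) * (z / \<i>)" by simp
    moreover have "Ln (of_real (sqrt (real p)) * (z / \<i>)) = of_real (ln (sqrt (real p))) + Ln (z / \<i>)"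
      using p z0 by (simp only: Ln_times_of_real Ln_of_real of_nat_0_less_iff real_sqrt_gt_0_iff divide_eq_0_iff complex_i_not_zero simp_thms)
    moreover have "ln (sqrt (real p)) = ln (real p) / 2" using p by (simp add: ln_sqrt)
    ultimately show ?thesis by (simp only:) simp
  qed
  finally show ?thesis by simp
qed

lemma sgn_of_int: "sgn (of_int n :: real) = of_int (sgn n)"
  by (simp add: sgn_if)

lemma Gamma0_upper_left_nonzero:
  fixes A B C D :: int
  assumes "prime p" "A * D - B * C = 1" "int p dvd C"
  shows "A \<noteq> 0"
proof
  assume "A = 0"
  then have "int p dvd 1" using assms(2,3) by (metis dvd_diff dvd_mult dvd_0_right mult_zero_left)
  then show False using assms(1) by simp
qed

text \<open>The Fricke involution after an element of \<open>Gamma0 p\<close>. For \<open>C \<noteq> 0\<close> two logarithms arise, of \<open>v\<close> from the element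
  of \<open>Gamma0 p\<close> and of \<open>s w / \<i>\<close> from the involution, both with positive real part. Their product
  differs from \<open>u\<close>, the right hand side's argument, by a factor \<open>\<plusminus> \<i>\<close>; half of the resulting
  \<open>\<plusminus> pi \<i> / 2\<close> is \<open>\<plusminus> 3\<close> in units of \<open>pi \<i> / 12\<close>. For \<open>C = 0\<close> only the second arises, and \<open>s w / \<i> = u\<close>.\<close>
lemma upper_log_eta_p_Fricke_coset:
  fixes A B C D :: int
  assumes p: "prime p" and det: "A * D - B * C = 1" and dvd: "int p dvd C" and z: "Im z > 0"
  defines "w \<equiv> (of_int A * z + of_int B) / (of_int C * z + of_int D)"
  shows "upper_log (eta_p p) (- 1 / (of_nat p * w)) =
    upper_log (eta_p p) z +
    Ln (of_real (sqrt (real p)) * (of_int A * z + of_int B) / (\<i> * of_int (sgn A))) / 2 +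
    of_real pi * \<i> / 12 *
      of_real (Phi_Gamma0 p (mat2 (of_int A) (of_int B) (of_int C) (of_int D)) - 3 * of_int (sgn (A * C)))"
proof -
  define s where "s = sqrt (real p)"
  have p0: "p > 0" using p by (rule prime_gt_0_nat)
  have s: "s > 0" using p0 by (simp add: s_def)
  have w: "Im w > 0" unfolding w_def by (rule Im_SL2Z_pos[OF det z])
  have den: "of_int C * z + of_int D \<noteq> 0" by (rule denominator_SL2Z_nonzero[OF det z])
  have A0: "A \<noteq> 0" by (rule Gamma0_upper_left_nonzero[OF p det dvd])
  define u where "u = of_real s * (of_int A * z + of_int B) / (\<i> * of_int (sgn A))"
  have u: "Re u > 0"
  proof -
    have "u = of_real s * ((of_int \<bar>A\<bar> * z + of_int (sgn A * B)) / \<i>)"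
      using A0 by (auto simp: u_def sgn_if field_simps abs_if)
    then show ?thesis using s z A0 by (simp add: Re_divide)
  qed
  have main: "upper_log (eta_p p) (- 1 / (of_nat p * w)) =
      upper_log (eta_p p) z +
      ((if C = 0 then 0 else Ln ((of_int C * z + of_int D) / (\<i> * of_int (sgn C)))) + Ln (of_real s * w / \<i>)) / 2 +
      of_real pi * \<i> / 12 * of_real (Phi_Gamma0 p (mat2 (of_int A) (of_int B) (of_int C) (of_int D)))"
    using upper_log_eta_p_fricke[OF p0 w] upper_log_eta_p_Gamma0[OF p0 det dvd z]
    by (simp add: w_def s_def add_divide_distrib)
  have logs: "(if C = 0 then 0 else Ln ((of_int C * z + of_int D) / (\<i> * of_int (sgn C)))) + Ln (of_real s * w / \<i>) =
      Ln u - \<i> * of_real pi / 2 * of_int (sgn (A * C))"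
  proof (cases "C = 0")
    case True
    then have "A * D = 1" using det by simp
    then have "D = sgn A" by (auto simp: zmult_eq_1_iff)
    moreover have "D = 1 \<or> D = - 1" using \<open>A * D = 1\<close> by (auto simp: zmult_eq_1_iff)
    ultimately have "of_real s * w / \<i> = u" by (auto simp: True w_def u_def)
    then show ?thesis by (simp add: True)
  next
    case False
    define v where "v = (of_int C * z + of_int D) / (\<i> * of_int (sgn C))"
    have "v = (of_int \<bar>C\<bar> * z + of_int (sgn C * D)) / \<i>"
      using False by (auto simp: v_def sgn_if field_simps abs_if)
    then have v: "Re v > 0" using z False by (simp add: Re_divide)
    define t where "t = - real_of_int (sgn (A * C))"
    have t: "t = 1 \<or> t = - 1" using A0 False by (auto simp: t_def sgn_mult sgn_if)
    have "v * (of_real s * w / \<i>) = \<i> * of_real t * u"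
    proof -
      have "of_int (sgn C) * of_int (sgn C) = (1 :: complex)" "of_int (sgn A) * of_int (sgn A) = (1 :: complex)"
        using A0 False by (auto simp: sgn_if)
      then show ?thesis
        using A0 False den by (simp add: v_def w_def u_def t_def sgn_mult sgn_eq_0_iff divide_simps)
    qed
    moreover have "Re (of_real s * w / \<i>) > 0" using s w by (simp add: Re_divide)
    ultimately have "Ln v + Ln (of_real s * w / \<i>) = Ln u + \<i> * of_real t * of_real pi / 2"
      using Ln_mult_Re_pos[OF v] Ln_mult_ii_Re_pos[OF u t] by metis
    then show ?thesis using False by (simp add: v_def t_def)
  qed
  show ?thesis
    unfolding main logs u_def s_def [symmetric] by (simp add: field_simps)
qed


section \<open>The normalizer of \<open>Gamma0 p\<close>\<close>

lemma mat2_eq_iff: "mat2 a b c d = mat2 a' b' c' d' \<longleftrightarrow> a = a' \<and> b = b' \<and> c = c' \<and> d = d'"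
  by (metis mat2_nth)

lemma mat2_mult:
  fixes a :: "'a :: comm_ring_1"
  shows "mat2 a b c d ** mat2 a' b' c' d' =
    mat2 (a * a' + b * c') (a * b' + b * d') (c * a' + d * c') (c * b' + d * d')"
  by (simp add: vec_eq_iff forall_2 matrix_matrix_mult_def sum_2)

lemma det_mat2: "det (mat2 a b c d) = a * d - b * (c :: 'a :: comm_ring_1)"
  by (simp add: det_2)

lemma mat2_1: "mat2 1 0 0 1 = (mat 1 :: 'a :: comm_ring_1 ^ 2 ^ 2)"
  by (simp add: vec_eq_iff forall_2 mat_def)

lemma mat2_in_Gamma0_iff:
  "mat2 a b c d \<in> Gamma0 p \<longleftrightarrow> (\<exists>A B C D :: int. a = of_int A \<and> b = of_int B \<and>
     c = of_int C \<and> d = of_int D \<and> A * D - B * C = 1 \<and> int p dvd C)"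
  unfolding Gamma0_def by (auto simp: mat2_eq_iff)

text \<open>The inverse of a matrix with determinant \<open>1\<close> is its adjugate.\<close>
lemma Gamma0_plus_conjugate:
  assumes \<gamma>: "mat2 a b c d \<in> Gamma0_plus p" and A: "A \<in> Gamma0 p"
  shows "mat2 a b c d ** A ** mat2 d (- b) (- c) a \<in> Gamma0 p"
    and "a * d - b * c = 1"
proof -
  let ?G = "mat2 a b c d"
  have G: "?G \<in> carrier SL2R"
    and stable: "?G <#\<^bsub>SL2R\<^esub> Gamma0 p #>\<^bsub>SL2R\<^esub> (inv\<^bsub>SL2R\<^esub> ?G) = Gamma0 p"
    using \<gamma> Gamma0_subset_SL2R unfolding Gamma0_plus_def normalizer_def stabilizer_def by auto
  show det: "a * d - b * c = 1" using G by (simp add: SL2R_def det_mat2)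
  have mult: "X \<otimes>\<^bsub>SL2R\<^esub> Y = X ** Y" for X Y by (simp add: SL2R_def)
  interpret group SL2R by (rule group_SL2R)
  have "inv\<^bsub>SL2R\<^esub> ?G = mat2 d (- b) (- c) a"
  proof (rule inv_equality)
    show "mat2 d (- b) (- c) a \<otimes>\<^bsub>SL2R\<^esub> ?G = \<one>\<^bsub>SL2R\<^esub>"
      using det by (simp add: SL2R_def mat2_mult mat2_1 [symmetric] mat2_eq_iff algebra_simps)
    show "mat2 d (- b) (- c) a \<in> carrier SL2R"
      using det by (simp add: SL2R_def det_mat2 algebra_simps)
  qed (rule G)
  moreover have "?G \<otimes>\<^bsub>SL2R\<^esub> A \<otimes>\<^bsub>SL2R\<^esub> inv\<^bsub>SL2R\<^esub> ?G \<in> ?G <#\<^bsub>SL2R\<^esub> Gamma0 p #>\<^bsub>SL2R\<^esub> (inv\<^bsub>SL2R\<^esub> ?G)"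
    using A unfolding l_coset_def r_coset_def by auto
  ultimately show "?G ** A ** mat2 d (- b) (- c) a \<in> Gamma0 p"
    unfolding stable by (simp only: mult)
qed

text \<open>A rational number with integral square is an integer.\<close>
lemma Ints_if_multiple_and_square_Ints:
  fixes x :: real and k :: int
  assumes "of_int k * x \<in> \<int>" "k \<noteq> 0" "x ^ 2 \<in> \<int>"
  shows "x \<in> \<int>"
proof -
  obtain n s where n: "of_int k * x = of_int n" and s: "x ^ 2 = of_int s"
    using assms by (auto elim!: Ints_cases)
  have "real_of_int (n ^ 2) = of_int (k ^ 2 * s)"
    using n s by (metis of_int_mult of_int_power power_mult_distrib)
  then have "n ^ 2 = k ^ 2 * s" by linarith
  then have "k ^ 2 dvd n ^ 2" by simp
  then have "k dvd n" by simp
  then obtain t where "n = k * t" by blast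
  then have "x = of_int t" using n assms(2) by simp
  then show ?thesis by simp
qed

lemma Ints_sqrt_of_coprime_factor:
  fixes x :: real and A C m :: int
  assumes "A * C = m ^ 2" "coprime A C" "A \<ge> 0" "C \<ge> 0" "x ^ 2 = of_int A"
  shows "x \<in> \<int>"
proof -
  have "int (nat A * nat C) = int (nat \<bar>m\<bar> ^ 2)" using assms by simp
  then have "nat A * nat C = nat \<bar>m\<bar> ^ 2" by (simp only: of_nat_eq_iff)
  then have "is_nth_power 2 (nat A * nat C)" by (metis is_nth_powerI)
  moreover have "coprime (nat A) (nat C)"
    using assms(2-4) by (simp add: coprime_int_iff [symmetric])
  ultimately have "is_nth_power 2 (nat A)" by (simp add: is_nth_power_mult_coprime_nat_iff)
  then obtain y where "nat A = y ^ 2" by (auto simp: is_nth_power_def)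
  then have "A = int y ^ 2" using assms(3) by (metis int_nat_eq of_nat_power)
  then have "x ^ 2 = real y ^ 2" using assms(5) by simp
  then have "x = real y \<or> x = - real y" by (simp add: power2_eq_iff)
  then show ?thesis by auto
qed

text \<open>A common divisor of \<open>A\<close> and \<open>C\<close> divides the squares of the consecutive integers
  \<open>a d = m\<close> and \<open>b c = m - 1\<close>.\<close>
lemma coprime_squares_of_column:
  fixes a b c d :: real and A B C D m :: int
  assumes p: "p > 0" and det: "a * d - b * c = 1"
    and A: "a ^ 2 = of_int A" and C: "c ^ 2 = of_int (int p * C)"
    and B: "real p * b ^ 2 = of_int B" and D: "d ^ 2 = of_int D" and m: "a * d = of_int m"
  shows "coprime A C"
proof (rule coprimeI)
  have "real_of_int (A * D) = of_int (m ^ 2)"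
    using A D m power_mult_distrib[of a d 2] by simp
  then have AD: "A * D = m ^ 2" by linarith
  have bc: "b * c = of_int (m - 1)" using det m by simp
  have "real p * of_int (B * C) = (real p * b ^ 2) * c ^ 2" by (simp add: B C)
  also have "\<dots> = real p * (b * c) ^ 2" by (simp add: power_mult_distrib)
  finally have "real_of_int (B * C) = of_int ((m - 1) ^ 2)" using p by (simp add: bc)
  then have BC: "B * C = (m - 1) ^ 2" by linarith
  fix e assume "e dvd A" "e dvd C"
  then have "e dvd m ^ 2" "e dvd (m - 1) ^ 2" using AD BC by (metis dvd_mult2 dvd_mult)+
  moreover have "coprime (m ^ 2) ((m - 1) ^ 2)" by simp
  ultimately show "is_unit e" using coprime_common_divisor by blast
qed

text \<open>As \<open>p\<close> does not divide \<open>A\<close>, the numbers \<open>A = a\<^sup>2\<close> and \<open>p C = c\<^sup>2\<close> are coprime. Their product is the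
  square of \<open>a c\<close>, so each is a perfect square and \<open>a\<close> and \<open>c\<close> are integers. As \<open>a\<close> is nonzero
  and \<open>a d\<close> is an integer, \<open>d\<close> is rational with integral square. Finally \<open>p b = a (p b d) - c (p b\<^sup>2)\<close> is an integer whose square is
  a multiple of \<open>p\<close>.\<close>
lemma in_Gamma0_of_integral_products:
  fixes a b c d :: real and A B C D M N m :: int
  assumes p: "prime p" and det: "a * d - b * c = 1"
    and A: "a ^ 2 = of_int A" and C: "c ^ 2 = of_int (int p * C)" and M: "a * c = of_int M"
    and B: "real p * b ^ 2 = of_int B" and D: "d ^ 2 = of_int D" and N: "real p * (b * d) = of_int N"
    and m: "a * d = of_int m" and pA: "\<not> int p dvd A"
  shows "mat2 a b c d \<in> Gamma0 p"
proof -
  have p0: "real p > 0" using p by (simp add: prime_gt_0_nat)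
  have "real_of_int (A * (int p * C)) = (a * c) ^ 2" by (simp add: A [symmetric] C [symmetric, simplified] power_mult_distrib)
  then have "real_of_int (A * (int p * C)) = of_int (M ^ 2)" by (simp add: M)
  then have AC: "A * (int p * C) = M ^ 2" by linarith
  have "coprime (int p) A"
    using p pA by (intro prime_imp_coprime) simp_all
  then have cop: "coprime A (int p * C)"
    using coprime_squares_of_column[OF _ det A C B D m] p0 by (simp add: coprime_commute)
  have "real_of_int A \<ge> 0" "real_of_int (int p * C) \<ge> 0"
    by (simp_all only: A [symmetric] C [symmetric] zero_le_power2)
  then have nonneg: "A \<ge> 0" "int p * C \<ge> 0" by linarith+
  have "a \<in> \<int>" by (rule Ints_sqrt_of_coprime_factor[OF AC cop nonneg A])
  then obtain a' where a': "a = of_int a'" by (elim Ints_cases)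
  have "c \<in> \<int>"
    by (rule Ints_sqrt_of_coprime_factor[of "int p * C" A M])
       (use AC cop nonneg C in \<open>simp_all add: mult_ac coprime_commute\<close>)
  then obtain c' where c': "c = of_int c'" by (elim Ints_cases)
  have "real_of_int (c' ^ 2) = of_int (int p * C)" using C by (simp add: c')
  then have "c' ^ 2 = int p * C" by linarith
  then have "int p dvd c' ^ 2" by simp
  then have dvd: "int p dvd c'" using p prime_dvd_power[of "int p" c' 2] by simp
  have a0: "a' \<noteq> 0" using A pA by (auto simp: a')
  have "d \<in> \<int>"
    by (rule Ints_if_multiple_and_square_Ints[of a']) (use m a0 D in \<open>simp_all add: a'\<close>)
  then obtain d' where d': "d = of_int d'" by (elim Ints_cases)
  have "real p * b = a * (real p * (b * d)) - c * (real p * b ^ 2)"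
  proof -
    have "a * (real p * (b * d)) - c * (real p * b ^ 2) = real p * b * (a * d - b * c)"
      by (simp add: algebra_simps power2_eq_square)
    then show ?thesis by (simp add: det)
  qed
  also have "\<dots> = of_int (a' * N - c' * B)" by (simp add: B N a' c')
  finally have pb: "real p * b = of_int (a' * N - c' * B)" .
  have "real_of_int ((a' * N - c' * B) ^ 2) = real p * (real p * b ^ 2)"
    by (simp only: of_int_power pb [symmetric]) (simp add: power2_eq_square)
  then have "real_of_int ((a' * N - c' * B) ^ 2) = of_int (int p * B)" by (simp add: B)
  then have "(a' * N - c' * B) ^ 2 = int p * B" by linarith
  then have "int p dvd (a' * N - c' * B) ^ 2" by simp
  then have "int p dvd a' * N - c' * B" using p prime_dvd_power[of "int p" _ 2] by simp
  then obtain b' where "a' * N - c' * B = int p * b'" by blast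
  then have b': "b = of_int b'" using pb p0 by simp
  have "real_of_int (a' * d' - b' * c') = of_int 1" using det by (simp add: a' b' c' d')
  then have "a' * d' - b' * c' = 1" by linarith
  then show ?thesis unfolding mat2_in_Gamma0_iff using a' b' c' d' dvd by blast
qed

text \<open>Conjugating the two unipotent matrices with an off-diagonal entry \<open>1\<close> and \<open>p\<close> shows that
  \<open>a\<^sup>2\<close>, \<open>a c\<close>, \<open>c\<^sup>2 / p\<close>, \<open>d\<^sup>2\<close>, \<open>p b d\<close> and \<open>p b\<^sup>2\<close> are integers. The first alternative holds if \<open>p\<close> does not
  divide \<open>a\<^sup>2\<close>. Multiplication by the inverse of the Fricke involution replaces \<open>a\<^sup>2\<close> by
  \<open>c\<^sup>2 / p\<close>, and \<open>p\<close> cannot divide both.\<close>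
theorem Gamma0_plus_cases:
  assumes p: "prime p" and \<gamma>: "mat2 a b c d \<in> Gamma0_plus p"
  obtains "mat2 a b c d \<in> Gamma0 p"
  | "mat2 (c / sqrt (real p)) (d / sqrt (real p))
       (- real p * a / sqrt (real p)) (- real p * b / sqrt (real p)) \<in> Gamma0 p"
proof -
  have p0: "real p > 0" using p by (simp add: prime_gt_0_nat)
  have "mat2 1 1 0 1 \<in> Gamma0 p"
    unfolding mat2_in_Gamma0_iff by (intro exI[of _ 1] exI[of _ 0]) auto
  note T = Gamma0_plus_conjugate[OF \<gamma> this]
  have "mat2 1 0 (real p) 1 \<in> Gamma0 p"
    unfolding mat2_in_Gamma0_iff by (intro exI[of _ 1] exI[of _ 0] exI[of _ "int p"]) auto
  note L = Gamma0_plus_conjugate(1)[OF \<gamma> this]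
  have det: "a * d - b * c = 1" by (rule T(2))
  have T': "mat2 a b c d ** mat2 1 1 0 1 ** mat2 d (- b) (- c) a =
      mat2 (1 - a * c) (a ^ 2) (- (c ^ 2)) (1 + a * c)"
    using det by (simp add: mat2_mult mat2_eq_iff algebra_simps power2_eq_square)
  have L': "mat2 a b c d ** mat2 1 0 (real p) 1 ** mat2 d (- b) (- c) a =
      mat2 (1 + real p * (b * d)) (- (real p * b ^ 2)) (real p * d ^ 2) (1 - real p * (b * d))"
    using det by (simp add: mat2_mult mat2_eq_iff algebra_simps power2_eq_square)
  obtain A M' C' where A: "a ^ 2 = of_int A" and M': "1 + a * c = of_int M'"
      and C': "- (c ^ 2) = of_int C'" "int p dvd C'"
    using T(1) unfolding T' mat2_in_Gamma0_iff by blast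
  obtain B' N' D' where B': "- (real p * b ^ 2) = of_int B'" and N': "1 + real p * (b * d) = of_int N'"
      and D': "real p * d ^ 2 = of_int D'" "int p dvd D'"
    using L unfolding L' mat2_in_Gamma0_iff by blast
  obtain C where "- C' = int p * C" using C'(2) by (metis dvdE dvd_minus_iff)
  moreover have "c ^ 2 = of_int (- C')" using C'(1) by simp
  ultimately have C: "c ^ 2 = of_int (int p * C)" by (simp only:)
  obtain D where "D' = int p * D" using D'(2) by blast
  then have D: "d ^ 2 = of_int D" using D'(1) p0 by simp
  define M N B where "M = M' - 1" and "N = N' - 1" and "B = - B'"
  have M: "a * c = of_int M" and N: "real p * (b * d) = of_int N" and B: "real p * b ^ 2 = of_int B"
    using M' N' B' by (simp_all add: M_def N_def B_def)
  have "real p * (a * d) = a ^ 2 * (real p * d ^ 2) - (a * c) * (real p * (b * d))"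
  proof -
    have "a ^ 2 * (real p * d ^ 2) - (a * c) * (real p * (b * d)) = real p * (a * d) * (a * d - b * c)"
      by (simp add: algebra_simps power2_eq_square)
    then show ?thesis by (simp add: det)
  qed
  also have "\<dots> = of_int (A * D' - M * N)" by (simp add: A D'(1) M N)
  finally have "of_int (int p) * (a * d) \<in> \<int>" by simp
  then have "a * d \<in> \<int>"
    by (rule Ints_if_multiple_and_square_Ints) (use p0 A D in \<open>simp_all add: power_mult_distrib\<close>)
  then obtain m where m: "a * d = of_int m" by (elim Ints_cases)
  show thesis
  proof (cases "int p dvd A")
    case False
    then show ?thesis
      using in_Gamma0_of_integral_products[OF p det A C M B D N m] that(1) by blast
  next
    case True
    have bc: "b * c = of_int (m - 1)" using det m by simp
    have "coprime A C"
      by (rule coprime_squares_of_column[OF _ det A C B D m]) (use p0 in simp)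
    then have pC: "\<not> int p dvd C"
      using True p by (metis coprime_common_divisor not_prime_unit prime_nat_int_transfer)
    define s where "s = sqrt (real p)"
    have s: "s > 0" "s * s = real p" using p0 by (simp_all add: s_def)
    have "mat2 (c / s) (d / s) (- real p * a / s) (- real p * b / s) \<in> Gamma0 p"
    proof (rule in_Gamma0_of_integral_products[OF p])
      show "c / s * (- real p * b / s) - d / s * (- real p * a / s) = 1"
        using det s p0 by (simp add: field_simps)
      show "(c / s) ^ 2 = of_int C"
        using C s p0 by (simp add: power2_eq_square)
      show "(- real p * a / s) ^ 2 = of_int (int p * A)"
        using A s p0 by (simp add: power2_eq_square)
      show "c / s * (- real p * a / s) = of_int (- M)"
        using M s p0 by (simp add: mult_ac)
      show "real p * (d / s) ^ 2 = of_int D"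
        using D s p0 by (simp add: power2_eq_square)
      show "(- real p * b / s) ^ 2 = of_int B"
        using B s p0 by (simp add: power2_eq_square mult_ac)
      show "real p * (d / s * (- real p * b / s)) = of_int (- N)"
        using N s p0 by (simp add: mult_ac)
      show "c / s * (- real p * b / s) = of_int (1 - m)"
        using bc s p0 by (simp add: mult_ac)
      show "\<not> int p dvd C" by (rule pC)
    qed
    then show ?thesis using that(2) by (simp add: s_def)
  qed
qed


section \<open>The transformation formula\<close>

theorem theorem1:
  fixes p :: nat and \<gamma> :: "real ^ 2 ^ 2" and a b c d :: real and z :: complex
  assumes "prime p" and "odd p"
    and "\<gamma> \<in> Gamma0_plus p" and "\<gamma> = mat2 a b c d"
    and "Im z > 0"
  shows "upper_log (eta_p p) ((a * z + b) / (c * z + d)) =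
           upper_log (eta_p p) z
           + (if c = 0 then 0
              else 1 / 2 * of_real ((sgn c)\<^sup>2) * Ln ((c * z + d) / (\<i> * of_real (sgn c))))
           + of_real pi * \<i> / 12 * of_real (Phi_p p \<gamma>)"
proof (cases "\<gamma> \<in> Gamma0 p")
  case True
  then obtain A B C D :: int where abcd: "a = of_int A" "b = of_int B" "c = of_int C" "d = of_int D"
      and det: "A * D - B * C = 1" and dvd: "int p dvd C"
    unfolding assms(4) mat2_in_Gamma0_iff by blast
  have "Phi_p p \<gamma> = Phi_Gamma0 p \<gamma>" using True by (simp add: Phi_p_def Let_def)
  moreover have "complex_of_real (sgn c) = of_int (sgn C)" by (simp add: abcd sgn_if)
  moreover have "c \<noteq> 0 \<Longrightarrow> (sgn c)\<^sup>2 = 1" by (simp add: sgn_if)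
  ultimately show ?thesis
    using upper_log_eta_p_Gamma0[OF prime_gt_0_nat[OF assms(1)] det dvd assms(5)]
    by (simp add: assms(4) abcd)
next
  case False
  define s where "s = sqrt (real p)"
  have p0: "real p > 0" using assms(1) by (simp add: prime_gt_0_nat)
  then have s: "s > 0" "s * s = real p" by (simp_all add: s_def)
  have \<gamma>': "mat2 (c / s) (d / s) (- real p * a / s) (- real p * b / s) \<in> Gamma0 p"
    using Gamma0_plus_cases[of p a b c d] assms(1,3,4) False unfolding s_def by blast
  then obtain A B C D :: int where ABCD: "c / s = of_int A" "d / s = of_int B"
      "- real p * a / s = of_int C" "- real p * b / s = of_int D"
      and det: "A * D - B * C = 1" and dvd: "int p dvd C"
    unfolding mat2_in_Gamma0_iff by blast
  have c: "c = s * of_int A" and d: "d = s * of_int B"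
    using ABCD(1,2) s by (simp_all add: field_simps)
  have a: "real p * a = - s * of_int C" and b: "real p * b = - s * of_int D"
    using ABCD(3,4) s by (simp_all add: field_simps)
  have A0: "A \<noteq> 0" by (rule Gamma0_upper_left_nonzero[OF assms(1) det dvd])
  have sgn_a: "sgn a = - sgn (of_int C)"
  proof -
    have "sgn (real p * a) = sgn (- s * of_int C)" by (simp only: a)
    then show ?thesis using p0 s by (simp add: sgn_mult)
  qed
  have sgn_c: "sgn c = of_int (sgn A)" using s by (simp add: c sgn_mult sgn_of_int)
  have c0: "c \<noteq> 0" using A0 s by (simp add: c)
  have "Phi_p p \<gamma> = Phi_Gamma0 p (mat2 (of_int A) (of_int B) (of_int C) (of_int D)) - 3 * of_int (sgn (A * C))"
  proof -
    have "sgn (- a * c) = of_int (sgn (A * C))"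
      by (simp add: sgn_mult sgn_a sgn_c sgn_of_int mult.commute)
    then show ?thesis
      using False ABCD by (simp add: Phi_p_def Let_def assms(4) s_def)
  qed
  moreover have "(a * z + b) / (c * z + d) =
      - 1 / (of_nat p * ((of_int A * z + of_int B) / (of_int C * z + of_int D)))"
  proof -
    define X Y where "X = of_int A * z + of_int B" and "Y = of_int C * z + of_int D"
    have "of_nat p * (a * z + b) = of_real (real p * a) * z + of_real (real p * b)"
      by (simp add: algebra_simps)
    also have "\<dots> = - (of_real s * Y)"
      unfolding a b Y_def by (simp add: algebra_simps)
    finally have "a * z + b = - (of_real s * Y / of_nat p)"
      using p0 by (simp add: field_simps)
    moreover have "c * z + d = of_real s * X"
      by (simp add: c d X_def algebra_simps)
    ultimately show ?thesis
      unfolding X_def [symmetric] Y_def [symmetric] using s by simp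
  qed
  moreover have "(c * z + d) / (\<i> * of_real (sgn c)) =
      of_real (sqrt (real p)) * (of_int A * z + of_int B) / (\<i> * of_int (sgn A))"
    by (simp add: c d sgn_c [unfolded c] s_def [symmetric] algebra_simps)
  moreover have "(sgn c)\<^sup>2 = 1" using c0 by (simp add: sgn_if)
  ultimately show ?thesis
    using upper_log_eta_p_Fricke_coset[OF assms(1) det dvd assms(5)] c0 by simp
qed

end
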